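(* Let $d=2$, $\rho>0$, $\beta>0$, and let $H(r)=\exp(-\beta r^{2})$ for $r>0$ and $H(0)=0$. Fix distinct $x,y\in\mathbb{R}^2$ and consider the random connection model $\mathcal{G}_H$ on $\mathcal{Y}^\star=\mathcal{Y}\cup\{x,y\}$. Then the number $\sigma_3$ of three-hop paths from $x$ to $y$ satisfies $$\mathrm{Var}(\sigma_3)=\mathbb{E}\sigma_3+\frac{\pi^3\rho^3}{\beta^3}\left(\frac14\exp\!\Big(-\frac{\beta\|x-y\|^2}{2}\Big)+\frac16\exp\!\Big(-\frac{3\beta\|x-y\|^2}{4}\Big)\right)+\frac{\pi^2\rho^2}{8\beta^2}\exp\!\big(-\beta\|x-y\|^2\big),$$ where $\mathbb{E}\sigma_3=\frac{\pi^2\rho^2}{3\beta^2}\exp\!\big(-\frac{\beta\|x-y\|^2}{3}\big)$.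
   Context: $\mathcal{Y}$ is a homogeneous Poisson point process on $\mathbb{R}^2$ of intensity $\rho$. The random connection model $\mathcal{G}_H$ on $\mathcal{Y}^\star=\mathcal{Y}\cup\{x,y\}$ is the random graph obtained, conditionally on $\mathcal{Y}$, by joining each unordered pair of distinct points $u,v\in\mathcal{Y}^\star$ by an edge independently with probability $H(\|u-v\|)$ (no self-loops), $\|\cdot\|$ the Euclidean norm. A three-hop path from $x$ to $y$ is an ordered pair $(A,B)$ of distinct points of $\mathcal{Y}$ such that $x\sim A$, $A\sim B$, $B\sim y$ in $\mathcal{G}_H$; $\sigma_3$ is the number of such paths. *)

theory Defs
  imports "HOL-Probability.Probability"
begin

definition gaussH :: "real \<Rightarrow> real \<Rightarrow> real" where
  "gaussH \<beta> r = (if r > 0 then exp (- \<beta> * r\<^sup>2) else 0)"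

definition pp_count :: "(nat \<Rightarrow> real^2) \<Rightarrow> (real^2) set \<Rightarrow> nat" where
  "pp_count X B = card {i. X i \<in> B}"

text \<open>Homogeneous Poisson point process of intensity rho on R^2, given as a
  random enumeration X of its (a.s. infinitely many, distinct) points:
  counts in bounded Borel sets are a.s. finite and Poisson(rho * Lebesgue(B)),
  and counts in finitely many pairwise disjoint bounded Borel sets are independent.\<close>
definition (in prob_space) poisson_pp :: "real \<Rightarrow> (nat \<Rightarrow> 'a \<Rightarrow> real^2) \<Rightarrow> bool" where
  "poisson_pp \<rho> X \<longleftrightarrow>
     (\<lambda>\<omega> i. X i \<omega>) \<in> measurable M (PiM UNIV (\<lambda>_. borel)) \<and>
     (AE \<omega> in M. inj (\<lambda>i. X i \<omega>)) \<and>
     (\<forall>B. B \<in> sets borel \<and> bounded B \<longrightarrow>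
        (AE \<omega> in M. finite {i. X i \<omega> \<in> B}) \<and>
        (\<forall>n. prob {\<omega> \<in> space M. pp_count (\<lambda>i. X i \<omega>) B = n}
               = exp (- (\<rho> * measure lborel B)) * (\<rho> * measure lborel B) ^ n / fact n)) \<and>
     (\<forall>(J::nat set) B. finite J \<longrightarrow> disjoint_family_on B J \<longrightarrow>
        (\<forall>j\<in>J. B j \<in> sets borel \<and> bounded (B j)) \<longrightarrow>
        indep_vars (\<lambda>_. count_space UNIV) (\<lambda>j \<omega>. pp_count (\<lambda>i. X i \<omega>) (B j)) J)"

text \<open>Indices of the independent uniform marks used to realise the edges:
  Ue i j (i < j) for the pair of points X i, X j; Ux i for x ~ X i; Uy i for X i ~ y.\<close>
datatype mark_idx = Ue nat nat | Ux nat | Uy nat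

text \<open>Random connection model on Y \<union> {x,y}: the marks U are i.i.d. uniform on
  [0,1], jointly independent of the point process, and two vertices u, v are
  joined iff their mark is < H(|u - v|); hence conditionally on Y the edges are
  independent with probability H(|u - v|).\<close>
definition (in prob_space) rcm_marks :: "(nat \<Rightarrow> 'a \<Rightarrow> real^2) \<Rightarrow> (mark_idx \<Rightarrow> 'a \<Rightarrow> real) \<Rightarrow> bool" where
  "rcm_marks X U \<longleftrightarrow>
     indep_vars (\<lambda>_. borel) U UNIV \<and>
     (\<forall>k. distributed M lborel (U k) (indicator {0..1})) \<and>
     (\<lambda>\<omega> k. U k \<omega>) \<in> measurable M (PiM UNIV (\<lambda>_. borel)) \<and>
     indep_set
       (sigma_sets (space M) {(\<lambda>\<omega> i. X i \<omega>) -` A \<inter> space M | A. A \<in> sets (PiM (UNIV::nat set) (\<lambda>_. borel))})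
       (sigma_sets (space M) {(\<lambda>\<omega> k. U k \<omega>) -` A \<inter> space M | A. A \<in> sets (PiM (UNIV::mark_idx set) (\<lambda>_. borel))})"

definition edge_pts :: "real \<Rightarrow> (mark_idx \<Rightarrow> 'a \<Rightarrow> real) \<Rightarrow> (nat \<Rightarrow> 'a \<Rightarrow> real^2) \<Rightarrow> nat \<Rightarrow> nat \<Rightarrow> 'a \<Rightarrow> bool" where
  "edge_pts \<beta> U X i j \<omega> \<longleftrightarrow> U (Ue (min i j) (max i j)) \<omega> < gaussH \<beta> (norm (X i \<omega> - X j \<omega>))"

definition sigma3 :: "real \<Rightarrow> real^2 \<Rightarrow> real^2 \<Rightarrow> (nat \<Rightarrow> 'a \<Rightarrow> real^2) \<Rightarrow> (mark_idx \<Rightarrow> 'a \<Rightarrow> real) \<Rightarrow> 'a \<Rightarrow> real" where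
  "sigma3 \<beta> x y X U \<omega> = real (card {(i, j). i \<noteq> j \<and>
      U (Ux i) \<omega> < gaussH \<beta> (norm (x - X i \<omega>)) \<and>
      edge_pts \<beta> U X i j \<omega> \<and>
      U (Uy j) \<omega> < gaussH \<beta> (norm (X j \<omega> - y))})"

end

theory Submission
  imports Defs
begin

text \<open>
  Away from the diagonals, the sets \<open>B\<^sub>1 \<times> \<dots> \<times> B\<^sub>n\<close> with pairwise disjoint bounded factors generate the
  Borel sets of $n$-tuples, and on such a set the expected number of $n$-tuples of points of the process is
  \<open>\<rho>\<^sup>n |B\<^sub>1| \<cdots> |B\<^sub>n|\<close> by independence. Hence the expected sum of a function over $n$-tuples of distinct
  points is its integral against $n$-fold Lebesgue measure times \<open>\<rho>\<^sup>n\<close>.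

  The square of the number of paths is a sum over pairs of paths \<open>(i, j)\<close>, \<open>(k, l)\<close>, and there are seven ways
  in which their vertices can coincide. Averaging over the marks replaces the indicator that
  both paths are present by the product of the connection probabilities over the union of their edges.
  Disjoint pairs contribute the square of the mean, equal pairs the mean, and the other five cases are
  Gaussian integrals over two or three points of the plane.
\<close>

section \<open>Multivariate Campbell formula\<close>

text \<open>Counts are independent only over disjoint sets; overlapping sets would bring in higher
  Poisson moments. Off the diagonals, the mean of a single Poisson variable is all that is needed,
  and nothing is lost: distinct indices give distinct points almost surely, and the diagonals are
  Lebesgue-null. All sums and integrals live in \<open>ennreal\<close>, so they can be interchanged
  before any finiteness is known; that the number of paths is almost surely finite comes out of its
  first moment.

  The Gaussian constants have a common origin. Multiplying weights between the same two points adds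
  their rates, and integrating out a point between rates s and t leaves st/(s+t): the parallel and
  series laws for conductances. Hence each exponent is the effective conductance between x and y in
  the union of the two paths, every edge having conductance \<beta>. With n inner points the
  prefactor is (pi \<rho> / \<beta>)^n divided by the determinant of the graph Laplacian (unit
  conductances) with the rows and columns of x and y removed: 3 for a single path, 8 for the
  reversed middle edge, 8 for a shared end edge, 12 for a vertex used in different
  positions.\<close>

definition num_points :: "(nat \<Rightarrow> 'b) \<Rightarrow> 'b set \<Rightarrow> ennreal" where
  "num_points X A = (\<integral>\<^sup>+ n. indicator A (X n) \<partial>count_space UNIV)"

text \<open>Finiteness matters: for infinitely many hits the left side is infinite, whereas
  \<open>pp_count\<close>, being a \<open>card\<close>, is 0.\<close>

lemma num_points_eq_pp_count:
  assumes "finite {i. X i \<in> A}"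
  shows "num_points X A = of_nat (pp_count X A)"
proof -
  have "num_points X A = (\<integral>\<^sup>+ n. indicator {i. X i \<in> A} n \<partial>count_space UNIV)"
    unfolding num_points_def by (intro nn_integral_cong) (auto split: split_indicator)
  then show ?thesis
    using assms by (simp add: pp_count_def)
qed

section \<open>Mean counts in disjoint bounded sets\<close>

context prob_space
begin

lemma poisson_nn_mean:
  fixes N :: "'a \<Rightarrow> nat"
  assumes [measurable]: "N \<in> measurable M (count_space UNIV)" and m: "m \<ge> 0"
    and N: "\<And>n. prob {\<omega> \<in> space M. N \<omega> = n} = exp (- m) * m ^ n / fact n"
  shows "(\<integral>\<^sup>+ \<omega>. of_nat (N \<omega>) \<partial>M) = ennreal m"
proof -
  have "(\<integral>\<^sup>+ \<omega>. of_nat (N \<omega>) \<partial>M)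
      = (\<integral>\<^sup>+ \<omega>. (\<integral>\<^sup>+ n. of_nat n * indicator {\<omega> \<in> space M. N \<omega> = n} \<omega> \<partial>count_space UNIV) \<partial>M)"
  proof (intro nn_integral_cong)
    fix \<omega> assume "\<omega> \<in> space M"
    then have "(\<integral>\<^sup>+ n. of_nat n * indicator {\<omega> \<in> space M. N \<omega> = n} \<omega> \<partial>count_space UNIV)
       = (\<integral>\<^sup>+ n. of_nat n * indicator {N \<omega>} n \<partial>count_space UNIV)"
      by (intro nn_integral_cong) (auto split: split_indicator)
    then show "of_nat (N \<omega>) = (\<integral>\<^sup>+ n. of_nat n * indicator {\<omega> \<in> space M. N \<omega> = n} \<omega> \<partial>count_space UNIV)"
      by simp
  qed
  also have "\<dots> = (\<Sum>n. \<integral>\<^sup>+ \<omega>. of_nat n * indicator {\<omega> \<in> space M. N \<omega> = n} \<omega> \<partial>M)"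
    by (simp add: nn_integral_count_space_nat nn_integral_suminf)
  also have "\<dots> = (\<Sum>n. ennreal (real n * (exp (- m) * m ^ n / fact n)))"
    by (simp add: nn_integral_cmult emeasure_eq_measure N ennreal_of_nat_eq_real_of_nat m
        ennreal_mult'[symmetric])
  also have "\<dots> = ennreal m"
  proof (rule suminf_ennreal_eq)
    \<comment> \<open>Scaled by m exp(-m), the exponential series is the mean series from index 1
      on; the term at 0 vanishes.\<close>
    have "(\<lambda>n. m ^ n /\<^sub>R fact n) sums exp m" by (rule exp_converges)
    then have "(\<lambda>n. (m * exp (- m)) * (m ^ n /\<^sub>R fact n)) sums ((m * exp (- m)) * exp m)"
      by (rule sums_mult)
    also have "(\<lambda>n. (m * exp (- m)) * (m ^ n /\<^sub>R fact n))
       = (\<lambda>n. real (Suc n) * (exp (- m) * m ^ Suc n / fact (Suc n)))"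
      by (auto simp: field_simps simp del: of_nat_Suc)
    also have "(m * exp (- m)) * exp m = m" by (simp add: exp_minus)
    finally show "(\<lambda>n. real n * (exp (- m) * m ^ n / fact n)) sums m"
      by (subst (asm) sums_Suc_iff) simp
  qed (use m in auto)
  finally show ?thesis .
qed

text \<open>Disjointness makes the counts independent, so the expected product is the product of the
  means. Almost sure finiteness on bounded sets allows passing from \<open>num_points\<close> to
  \<open>pp_count\<close>, to which the Poisson law applies.\<close>

lemma poisson_pp_num_points_prod:
  fixes J :: "nat set" and A :: "nat \<Rightarrow> (real^2) set"
  assumes P: "poisson_pp \<rho> X" and \<rho>: "\<rho> > 0" and J: "finite J" "disjoint_family_on A J"
    and A: "\<And>j. j \<in> J \<Longrightarrow> A j \<in> sets borel" "\<And>j. j \<in> J \<Longrightarrow> bounded (A j)"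
  shows "(\<integral>\<^sup>+ \<omega>. (\<Prod>j\<in>J. num_points (\<lambda>i. X i \<omega>) (A j)) \<partial>M)
       = (\<Prod>j\<in>J. emeasure (density lborel (\<lambda>_. ennreal \<rho>)) (A j))"
proof -
  let ?N = "\<lambda>j \<omega>. pp_count (\<lambda>i. X i \<omega>) (A j)"
  have ind: "indep_vars (\<lambda>_. count_space UNIV) ?N J"
    using P J A by (auto simp: poisson_pp_def)
  have mean: "(\<integral>\<^sup>+ \<omega>. of_nat (?N j \<omega>) \<partial>M) = emeasure (density lborel (\<lambda>_. ennreal \<rho>)) (A j)" if "j \<in> J" for j
  proof -
    have "?N j \<in> measurable M (count_space UNIV)"
      using ind that by (auto simp: indep_vars_def)
    moreover have "\<And>n. prob {\<omega> \<in> space M. ?N j \<omega> = n}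
        = exp (- (\<rho> * measure lborel (A j))) * (\<rho> * measure lborel (A j)) ^ n / fact n"
      using P A[OF that] by (auto simp: poisson_pp_def)
    ultimately have "(\<integral>\<^sup>+ \<omega>. of_nat (?N j \<omega>) \<partial>M) = ennreal (\<rho> * measure lborel (A j))"
      using \<rho> by (intro poisson_nn_mean) auto
    also have "\<dots> = ennreal \<rho> * emeasure lborel (A j)"
      using emeasure_bounded_finite[OF A(2)[OF that]] \<rho>
      by (simp add: ennreal_mult' emeasure_eq_ennreal_measure less_top[symmetric])
    finally show ?thesis
      using A(1)[OF that] by (simp add: emeasure_density nn_integral_cmult)
  qed
  have "AE \<omega> in M. finite {i. X i \<omega> \<in> A j}" if "j \<in> J" for j
    using P A[OF that] by (auto simp: poisson_pp_def)
  then have "AE \<omega> in M. \<forall>j\<in>J. finite {i. X i \<omega> \<in> A j}"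
    using J(1) by (intro AE_finite_allI) auto
  then have "AE \<omega> in M. (\<Prod>j\<in>J. num_points (\<lambda>i. X i \<omega>) (A j)) = (\<Prod>j\<in>J. of_nat (?N j \<omega>))"
    by eventually_elim (intro prod.cong refl num_points_eq_pp_count, auto)
  then have "(\<integral>\<^sup>+ \<omega>. (\<Prod>j\<in>J. num_points (\<lambda>i. X i \<omega>) (A j)) \<partial>M)
      = (\<integral>\<^sup>+ \<omega>. (\<Prod>j\<in>J. of_nat (?N j \<omega>)) \<partial>M)"
    by (rule nn_integral_cong_AE)
  also have "\<dots> = (\<Prod>j\<in>J. \<integral>\<^sup>+ \<omega>. of_nat (?N j \<omega>) \<partial>M)"
    by (intro indep_vars_nn_integral indep_vars_compose2[OF ind] J) auto
  also have "\<dots> = (\<Prod>j\<in>J. emeasure (density lborel (\<lambda>_. ennreal \<rho>)) (A j))"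
    by (intro prod.cong refl mean)
  finally show ?thesis .
qed

end

section \<open>Separating distinct points by countably many bounded open sets\<close>

lemma separating_balls:
  fixes x :: "'i \<Rightarrow> 'b::metric_space"
  assumes I: "finite I" and inj: "inj_on x I"
  obtains r where "r > 0" "disjoint_family_on (\<lambda>i. ball (x i) r) I"
proof -
  \<comment> \<open>The inserted 1 keeps \<open>D\<close> nonempty, so that \<open>Min D\<close> is
    meaningful even when there is no pair of distinct indices.\<close>
  define D where "D = insert 1 ((\<lambda>p. dist (x (fst p)) (x (snd p))) ` {p \<in> I \<times> I. fst p \<noteq> snd p})"
  have fin: "finite D"
    unfolding D_def using I by simp
  have pos: "Min D > 0"
    using inj fin by (subst Min_gr_iff) (auto simp: D_def inj_on_def)
  have "ball (x i) (Min D / 2) \<inter> ball (x j) (Min D / 2) = {}" if "i \<in> I" "j \<in> I" "i \<noteq> j" for i j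
  proof -
    have "dist (x i) (x j) \<in> D"
      unfolding D_def using that by force
    then have "Min D \<le> dist (x i) (x j)"
      using fin by (rule Min_le[rotated])
    then show ?thesis
      by (intro disjoint_ballI) simp
  qed
  then have "disjoint_family_on (\<lambda>i. ball (x i) (Min D / 2)) I"
    unfolding disjoint_family_on_def by simp
  then show ?thesis
    using pos by (intro that) simp_all
qed

text \<open>A countable basis has members inside the balls of \<open>separating_balls\<close>, and
  these are bounded because the balls are. Countability is what later allows the off-diagonal set to
  be cut into countably many pieces.\<close>

lemma countable_separating_family:
  obtains \<B> :: "'b::euclidean_space set set" where "countable \<B>"
    "\<And>B. B \<in> \<B> \<Longrightarrow> open B" "\<And>B. B \<in> \<B> \<Longrightarrow> bounded B"
    "\<And>(I :: 'i set) x. finite I \<Longrightarrow> inj_on x I \<Longrightarrow>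
       \<exists>C. (\<forall>i\<in>I. C i \<in> \<B> \<and> x i \<in> C i) \<and> disjoint_family_on C I"
proof -
  obtain \<K> :: "'b set set" where K: "countable \<K>" "topological_basis \<K>"
    using ex_countable_basis by blast
  show ?thesis
  proof (rule that[of "{B \<in> \<K>. bounded B}"])
    fix I :: "'i set" and x :: "'i \<Rightarrow> 'b" assume I: "finite I" "inj_on x I"
    obtain r where r: "r > 0" "disjoint_family_on (\<lambda>i. ball (x i) r) I"
      by (rule separating_balls[OF I])
    have "\<exists>B. B \<in> \<K> \<and> x i \<in> B \<and> B \<subseteq> ball (x i) r" for i
      using topological_basisE[OF K(2) open_ball, of "x i" "x i" r]
      by (metis centre_in_ball r(1))
    then obtain C where C: "\<And>i. C i \<in> \<K>" "\<And>i. x i \<in> C i" "\<And>i. C i \<subseteq> ball (x i) r"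
      by metis
    have "bounded (C i)" for i by (rule bounded_subset[OF bounded_ball C(3)])
    moreover have "disjoint_family_on C I"
      using r(2) C(3) unfolding disjoint_family_on_def by blast
    ultimately show "\<exists>C. (\<forall>i\<in>I. C i \<in> {B \<in> \<K>. bounded B} \<and> x i \<in> C i) \<and> disjoint_family_on C I"
      using C(1,2) by (intro exI[of _ C]) simp
  qed (use K topological_basis_open in auto)
qed

lemma indicator_restrict_PiE:
  assumes "finite I"
  shows "(indicator (PiE I A) (\<lambda>i\<in>I. g i) :: ennreal) = (\<Prod>i\<in>I. indicator (A i) (g i))"
proof (cases "\<forall>i\<in>I. g i \<in> A i")
  case True
  then show ?thesis by (auto simp: indicator_def)
next
  case False
  then have "\<exists>i\<in>I. indicator (A i) (g i) = (0 :: ennreal)" by (meson indicator_simps(2))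
  then have "(\<Prod>i\<in>I. indicator (A i) (g i)) = (0 :: ennreal)"
    using assms by (intro prod_zero) auto
  moreover have "(\<lambda>i\<in>I. g i) \<notin> PiE I A" using False by auto
  ultimately show ?thesis by simp
qed

section \<open>The moment measure of the process\<close>

context prob_space
begin

text \<open>This is the moment measure: the expected number of index tuples whose points land in a
  set, repeated indices allowed. Repetitions put extra mass on the diagonals; off them it is the
  factorial moment measure. As a push-forward from a product with counting measures, its integrals
  are accessible by Tonelli.\<close>

definition tuple_measure :: "nat set \<Rightarrow> (nat \<Rightarrow> 'a \<Rightarrow> 'b::topological_space) \<Rightarrow> (nat \<Rightarrow> 'b) measure" where
  "tuple_measure I X = distr (M \<Otimes>\<^sub>M PiM I (\<lambda>_. count_space UNIV)) (PiM I (\<lambda>_. borel))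
     (\<lambda>(\<omega>, s). \<lambda>i\<in>I. X (s i) \<omega>)"

lemma tuple_map_measurable:
  fixes X :: "nat \<Rightarrow> 'a \<Rightarrow> 'b::topological_space"
  assumes "\<And>i. X i \<in> borel_measurable M"
  shows "(\<lambda>(\<omega>, s). \<lambda>i\<in>I. X (s i) \<omega>) \<in> measurable (M \<Otimes>\<^sub>M PiM I (\<lambda>_. count_space UNIV)) (PiM I (\<lambda>_. borel))"
proof -
  note assms[measurable]
  have "(\<lambda>p. X (snd p i) (fst p)) \<in> borel_measurable (M \<Otimes>\<^sub>M PiM I (\<lambda>_. count_space UNIV))" if [measurable]: "i \<in> I" for i
    \<comment> \<open>The index \<open>s i\<close> itself varies with the tuple, so measurability is
      obtained by splitting over its countably many values.\<close>
    by (rule measurable_compose_countable[where f="\<lambda>n p. X n (fst p)" and g="\<lambda>p. snd p i"]) measurable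
  then show ?thesis
    by (auto simp: split_beta intro!: measurable_restrict)
qed

lemma nn_integral_tuple_measure:
  fixes X :: "nat \<Rightarrow> 'a \<Rightarrow> 'b::topological_space"
  assumes I: "finite I" and X: "\<And>i. X i \<in> borel_measurable M" and [measurable]: "f \<in> borel_measurable (PiM I (\<lambda>_. borel))"
  shows "integral\<^sup>N (tuple_measure I X) f
     = (\<integral>\<^sup>+ \<omega>. (\<integral>\<^sup>+ s. f (\<lambda>i\<in>I. X (s i) \<omega>) \<partial>PiM I (\<lambda>_. count_space UNIV)) \<partial>M)"
proof -
  interpret product_sigma_finite "\<lambda>_::nat. count_space (UNIV :: nat set)"
    by (intro product_sigma_finite.intro sigma_finite_measure_count_space)
  interpret P: finite_product_sigma_finite "\<lambda>_::nat. count_space (UNIV :: nat set)" I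
    by standard (fact I)
  note tuple_map_measurable[OF X, measurable]
  show ?thesis
    unfolding tuple_measure_def
    by (subst nn_integral_distr, simp, simp, subst P.nn_integral_fst[symmetric], simp_all)
qed

text \<open>The indicator of a box is a product over coordinates, so the sum over all index tuples
  factors into separate counts. This factorisation is the reason for allowing repeated indices in
  \<open>tuple_measure\<close>.\<close>

lemma emeasure_tuple_measure_PiE:
  fixes X :: "nat \<Rightarrow> 'a \<Rightarrow> 'b::topological_space"
  assumes I: "finite I" and X: "\<And>i. X i \<in> borel_measurable M" and A: "\<And>i. i \<in> I \<Longrightarrow> A i \<in> sets borel"
  shows "emeasure (tuple_measure I X) (PiE I A) = (\<integral>\<^sup>+ \<omega>. (\<Prod>i\<in>I. num_points (\<lambda>n. X n \<omega>) (A i)) \<partial>M)"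
proof -
  interpret product_sigma_finite "\<lambda>_::nat. count_space (UNIV :: nat set)"
    by (intro product_sigma_finite.intro sigma_finite_measure_count_space)
  have [measurable]: "PiE I A \<in> sets (PiM I (\<lambda>_. borel))"
    using I A by (intro sets_PiM_I_finite) auto
  have "emeasure (tuple_measure I X) (PiE I A) = integral\<^sup>N (tuple_measure I X) (indicator (PiE I A))"
    by (subst nn_integral_indicator) (auto simp: tuple_measure_def)
  also have "\<dots> = (\<integral>\<^sup>+ \<omega>. (\<integral>\<^sup>+ s. (\<Prod>i\<in>I. indicator (A i) (X (s i) \<omega>)) \<partial>PiM I (\<lambda>_. count_space UNIV)) \<partial>M)"
    by (subst nn_integral_tuple_measure[OF I X])
      (simp_all add: indicator_restrict_PiE I)
  also have "\<dots> = (\<integral>\<^sup>+ \<omega>. (\<Prod>i\<in>I. num_points (\<lambda>n. X n \<omega>) (A i)) \<partial>M)"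
    unfolding num_points_def by (intro nn_integral_cong product_nn_integral_prod I) auto
  finally show ?thesis .
qed

end

section \<open>The product intensity measure and its null diagonals\<close>

abbreviation intensity_measure :: "real \<Rightarrow> (real^2) measure" where
  "intensity_measure \<rho> \<equiv> density lborel (\<lambda>_. ennreal \<rho>)"

lemma sigma_finite_intensity_measure: "sigma_finite_measure (intensity_measure \<rho>)"
  using sigma_finite_measure.sigma_finite_iff_density_finite[OF sigma_finite_lborel, of "\<lambda>_. ennreal \<rho>"] by simp

lemma sets_PiM_intensity_measure:
  "sets (PiM I (\<lambda>_. intensity_measure \<rho>)) = sets (PiM I (\<lambda>_. borel))"
  by (intro sets_PiM_cong) simp_all

lemma sets_inj_on_PiM:
  assumes I: "finite I"
  shows "{x \<in> space (PiM I (\<lambda>_. borel :: (real^2) measure)). inj_on x I} \<in> sets (PiM I (\<lambda>_. borel))"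
proof -
  \<comment> \<open>Coincidence of coordinates is phrased as \<open>dist\<close> = 0, a condition on
    a measurable real function.\<close>
  have "Measurable.pred (PiM I (\<lambda>_. borel :: (real^2) measure)) (\<lambda>x. \<forall>i\<in>I. \<forall>j\<in>I. dist (x i) (x j) = 0 \<longrightarrow> i = j)"
    using I by measurable
  then show ?thesis
    by (simp add: inj_on_def pred_def)
qed

text \<open>Integrating over coordinate i first, each slice of the diagonal between i and j is the
  single point \<open>x j\<close>, which is Lebesgue-null. There are finitely many such
  diagonals.\<close>

lemma AE_PiM_intensity_measure_inj_on:
  assumes I: "finite I"
  shows "AE x in PiM I (\<lambda>_. intensity_measure \<rho>). inj_on x I"
proof -
  interpret product_sigma_finite "\<lambda>_. intensity_measure \<rho>"
    by (intro product_sigma_finite.intro sigma_finite_intensity_measure)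
  have "AE x in PiM I (\<lambda>_. intensity_measure \<rho>). dist (x i) (x j) \<noteq> 0" if ij: "i \<in> I" "j \<in> I" "i \<noteq> j" for i j
  proof -
    have [measurable]: "(\<lambda>x. x k) \<in> measurable (PiM I (\<lambda>_. intensity_measure \<rho>)) borel" if "k \<in> I" for k
      using measurable_component_singleton[OF that, of "\<lambda>_. intensity_measure \<rho>"] by simp
    let ?D = "{x \<in> space (PiM I (\<lambda>_. intensity_measure \<rho>)). dist (x i) (x j) = 0}"
    have D: "?D \<in> sets (PiM I (\<lambda>_. intensity_measure \<rho>))"
      using ij by measurable
    have II: "insert i (I - {i}) = I" using ij by auto
    have "emeasure (PiM I (\<lambda>_. intensity_measure \<rho>)) ?D
        = integral\<^sup>N (PiM (insert i (I - {i})) (\<lambda>_. intensity_measure \<rho>)) (indicator ?D)"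
      using D by (simp only: II nn_integral_indicator)
    also have "\<dots> = (\<integral>\<^sup>+ x. (\<integral>\<^sup>+ y. indicator ?D (x(i := y)) \<partial>intensity_measure \<rho>)
        \<partial>PiM (I - {i}) (\<lambda>_. intensity_measure \<rho>))"
      using I D by (intro product_nn_integral_insert) (simp_all add: II del: insert_Diff_single)
    also have "\<dots> \<le> (\<integral>\<^sup>+ x. (\<integral>\<^sup>+ y. indicator {x j} y \<partial>intensity_measure \<rho>)
        \<partial>PiM (I - {i}) (\<lambda>_. intensity_measure \<rho>))"
      using ij by (intro nn_integral_mono) (auto split: split_indicator)
    also have "\<dots> = 0"
      by (simp add: emeasure_density nn_integral_cmult)
    finally show ?thesis
      using D by (subst AE_iff_measurable[OF _ refl]) simp_all
  qed
  then have "AE x in PiM I (\<lambda>_. intensity_measure \<rho>). \<forall>p\<in>{p \<in> I \<times> I. fst p \<noteq> snd p}. dist (x (fst p)) (x (snd p)) \<noteq> 0"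
    using I by (intro AE_finite_allI) auto
  then show ?thesis
    by eventually_elim (auto simp: inj_on_def)
qed

section \<open>Agreement of both measures off the diagonals\<close>

context prob_space
begin

lemma poisson_pp_measurable:
  assumes "poisson_pp \<rho> X"
  shows "X i \<in> borel_measurable M"
proof -
  have "(\<lambda>\<omega> i. X i \<omega>) \<in> measurable M (PiM UNIV (\<lambda>_. borel))"
    using assms by (simp add: poisson_pp_def)
  from measurable_compose[OF this measurable_component_singleton[of i UNIV]] show ?thesis by simp
qed

text \<open>The two measures can differ on diagonals, so the uniqueness theorem for measures
  agreeing on boxes is applied to their restrictions to one box with disjoint factors. Every sub-box
  inherits disjoint bounded factors, hence \<open>poisson_pp_num_points_prod\<close> applies to
  it.\<close>

lemma tuple_measure_eq_on_disjoint_boxes: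
  assumes P: "poisson_pp \<rho> X" and \<rho>: "\<rho> > 0" and I: "finite I"
    and C: "\<And>i. i \<in> I \<Longrightarrow> open (C i)" "\<And>i. i \<in> I \<Longrightarrow> bounded (C i)" "disjoint_family_on C I"
    and A: "A \<in> sets (PiM I (\<lambda>_. borel))" "A \<subseteq> PiE I C"
  shows "emeasure (tuple_measure I X) A = emeasure (PiM I (\<lambda>_. intensity_measure \<rho>)) A"
proof -
  interpret product_sigma_finite "\<lambda>_. intensity_measure \<rho>"
    by (intro product_sigma_finite.intro sigma_finite_intensity_measure)
  let ?\<mu> = "tuple_measure I X" and ?\<pi> = "PiM I (\<lambda>_. intensity_measure \<rho>)"
  note X = poisson_pp_measurable[OF P]
  have sets: "sets ?\<mu> = sets (PiM I (\<lambda>_. borel))" "sets ?\<pi> = sets (PiM I (\<lambda>_. borel))"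
    by (simp_all add: tuple_measure_def sets_PiM_intensity_measure)
  have Cs: "PiE I C \<in> sets (PiM I (\<lambda>_. borel))"
    using I C by (intro sets_PiM_I_finite) auto
  have rect: "emeasure ?\<mu> (PiE I B) = emeasure ?\<pi> (PiE I B)"
    if B: "\<And>i. i \<in> I \<Longrightarrow> B i \<in> sets borel" "\<And>i. i \<in> I \<Longrightarrow> B i \<subseteq> C i" for B
  proof -
    have "disjoint_family_on B I"
      using C(3) B(2) unfolding disjoint_family_on_def by blast
    moreover have "bounded (B i)" if "i \<in> I" for i
      by (rule bounded_subset[OF C(2)[OF that] B(2)[OF that]])
    ultimately show ?thesis
      using B by (simp add: emeasure_tuple_measure_PiE[OF I X] emeasure_PiM[OF I]
        poisson_pp_num_points_prod[OF P \<rho> I])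
  qed
  have "density ?\<mu> (indicator (PiE I C)) = density ?\<pi> (indicator (PiE I C))"
  \<comment> \<open>The restricted measures are finite because the factors \<open>C i\<close> are
    bounded, so the constant sequence of the whole space serves as the exhausting sequence.\<close>
  proof (rule measure_eqI_PiM_finite[OF I, where M="\<lambda>_. borel" and A="\<lambda>_. PiE I (\<lambda>_. UNIV)"])
    show "emeasure (density ?\<mu> (indicator (PiE I C))) (PiE I B)
        = emeasure (density ?\<pi> (indicator (PiE I C))) (PiE I B)"
      if B: "\<And>i. i \<in> I \<Longrightarrow> B i \<in> sets borel" for B
    proof -
      have "PiE I B \<in> sets (PiM I (\<lambda>_. borel))"
        using I B by (intro sets_PiM_I_finite) auto
      then show ?thesis
        using Cs B C(1) by (simp add: emeasure_restricted sets PiE_Int) (intro rect, auto)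
    qed
    show "range (\<lambda>_. PiE I (\<lambda>_. UNIV)) \<subseteq> prod_algebra I (\<lambda>_. borel)"
      using I by (auto intro!: prod_algebraI_finite)
    have "emeasure ?\<mu> (PiE I C) = (\<Prod>i\<in>I. emeasure (intensity_measure \<rho>) (C i))"
      using rect[of C] C(1) by (simp add: emeasure_PiM[OF I])
    also have "\<dots> \<noteq> \<infinity>"
    proof -
      have "emeasure (intensity_measure \<rho>) (C i) \<noteq> \<infinity>" if "i \<in> I" for i
        using emeasure_bounded_finite[OF C(2)[OF that]] C(1)[OF that]
        by (simp add: emeasure_density nn_integral_cmult ennreal_mult_eq_top_iff)
      then show ?thesis by (simp add: ennreal_prod_eq_top)
    qed
    finally show "emeasure (density ?\<mu> (indicator (PiE I C))) (PiE I (\<lambda>_. UNIV)) \<noteq> \<infinity>"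
      using Cs I by (subst emeasure_restricted) (auto simp: sets PiE_Int intro!: sets_PiM_I_finite)
  qed (simp_all add: sets space_PiM)
  then have "emeasure (density ?\<mu> (indicator (PiE I C))) A = emeasure (density ?\<pi> (indicator (PiE I C))) A"
    by simp
  then show ?thesis
    using A Cs by (simp add: emeasure_restricted sets Int_absorb1)
qed

text \<open>An injective tuple has coordinates in pairwise disjoint members of the separating
  family, so countably many boxes with disjoint factors cover A, and equality on each piece adds
  up.\<close>

lemma tuple_measure_eq_on_distinct:
  assumes P: "poisson_pp \<rho> X" and \<rho>: "\<rho> > 0" and I: "finite I"
    and A: "A \<in> sets (PiM I (\<lambda>_. borel))" "\<And>x. x \<in> A \<Longrightarrow> inj_on x I"
  shows "emeasure (tuple_measure I X) A = emeasure (PiM I (\<lambda>_. intensity_measure \<rho>)) A"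
proof -
  let ?\<mu> = "tuple_measure I X" and ?\<pi> = "PiM I (\<lambda>_. intensity_measure \<rho>)"
  obtain \<B> :: "(real^2) set set" where B: "countable \<B>"
    "\<And>B. B \<in> \<B> \<Longrightarrow> open B" "\<And>B. B \<in> \<B> \<Longrightarrow> bounded B"
    "\<And>(I :: nat set) x. finite I \<Longrightarrow> inj_on x I \<Longrightarrow>
       \<exists>C. (\<forall>i\<in>I. C i \<in> \<B> \<and> x i \<in> C i) \<and> disjoint_family_on C I"
    using countable_separating_family by blast
  \<comment> \<open>Taking the choices from \<open>PiE\<close> makes them undefined outside I;
    otherwise the family would not be countable.\<close>
  define \<C> where "\<C> = {C \<in> PiE I (\<lambda>_. \<B>). disjoint_family_on C I}"
  have cnt: "countable \<C>"
    unfolding \<C>_def by (intro countable_Collect countable_PiE I B)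
  have cover: "\<exists>C\<in>\<C>. x \<in> PiE I C" if x: "x \<in> A" for x
  proof -
    obtain C where C: "\<forall>i\<in>I. C i \<in> \<B> \<and> x i \<in> C i" "disjoint_family_on C I"
      using B(4)[OF I A(2)[OF x]] by blast
    have "x \<in> extensional I"
      using sets.sets_into_space[OF A(1)] x by (auto simp: space_PiM PiE_def)
    then show ?thesis
      using C by (intro bexI[of _ "restrict C I"])
        (auto simp: \<C>_def PiE_iff disjoint_family_on_def)
  qed
  show ?thesis
  proof (cases "\<C> = {}")
    case True
    then show ?thesis using cover by (cases "A = {}") auto
  next
    case False
    \<comment> \<open>The boxes overlap; \<open>disjointed\<close> makes the pieces disjoint while
      keeping each one inside a single box.\<close>
    define E where "E n = A \<inter> disjointed (\<lambda>n. PiE I (from_nat_into \<C> n)) n" for n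
    have mem: "from_nat_into \<C> n \<in> \<C>" for n
      using False by (rule from_nat_into)
    have rect: "PiE I (from_nat_into \<C> n) \<in> sets (PiM I (\<lambda>_. borel))" for n
      using mem[of n] B(2) by (intro sets_PiM_I_finite I) (auto simp: \<C>_def PiE_iff)
    have E: "E n \<in> sets (PiM I (\<lambda>_. borel))" for n
      unfolding E_def using sets.range_disjointed_sets[of "\<lambda>n. PiE I (from_nat_into \<C> n)" "PiM I (\<lambda>_. borel)"] rect A
      by (intro sets.Int) auto
    have E_eq: "emeasure ?\<mu> (E n) = emeasure ?\<pi> (E n)" for n
    proof (rule tuple_measure_eq_on_disjoint_boxes[OF P \<rho> I])
      show "E n \<subseteq> PiE I (from_nat_into \<C> n)"
        unfolding E_def using disjointed_subset[of "\<lambda>n. PiE I (from_nat_into \<C> n)"] by blast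
    qed (use mem[of n] B(2,3) E in \<open>auto simp: \<C>_def PiE_iff\<close>)
    have disj: "disjoint_family E"
      using disjoint_family_disjointed[of "\<lambda>n. PiE I (from_nat_into \<C> n)"]
      unfolding E_def disjoint_family_on_def by blast
    have UN: "(\<Union>n. E n) = A"
    proof -
      have "(\<Union>n. E n) = A \<inter> (\<Union>n. PiE I (from_nat_into \<C> n))"
        by (simp add: E_def UN_disjointed_eq flip: Int_UN_distrib)
      also have "\<dots> = A"
        using cover from_nat_into_surj[OF cnt] by fastforce
      finally show ?thesis .
    qed
    have "emeasure ?\<mu> A = (\<Sum>n. emeasure ?\<mu> (E n))"
      using E disj by (subst UN[symmetric], subst suminf_emeasure) (auto simp: tuple_measure_def)
    also have "\<dots> = (\<Sum>n. emeasure ?\<pi> (E n))"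
      by (simp add: E_eq)
    also have "\<dots> = emeasure ?\<pi> A"
      using E disj by (subst UN[symmetric], subst suminf_emeasure) (auto simp: sets_PiM_intensity_measure)
    finally show ?thesis .
  qed
qed

text \<open>Since the enumeration is almost surely injective, distinct indices are the same as
  distinct points, and the left side becomes the integral of f against \<open>tuple_measure\<close>
  restricted to injective tuples. There it agrees with the product measure, for which the
  restriction drops out because the diagonals are null.\<close>

theorem poisson_pp_multivariate_campbell:
  fixes I :: "nat set"
  assumes P: "poisson_pp \<rho> X" and \<rho>: "\<rho> > 0" and I: "finite I"
    and f[measurable]: "f \<in> borel_measurable (PiM I (\<lambda>_. borel))"
  shows "(\<integral>\<^sup>+ \<omega>. (\<integral>\<^sup>+ s. (if inj_on s I then f (\<lambda>i\<in>I. X (s i) \<omega>) else 0)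
            \<partial>PiM I (\<lambda>_. count_space UNIV)) \<partial>M)
       = integral\<^sup>N (PiM I (\<lambda>_. intensity_measure \<rho>)) f"
proof -
  let ?\<mu> = "tuple_measure I X" and ?\<pi> = "PiM I (\<lambda>_. intensity_measure \<rho>)"
  let ?O = "{x \<in> space (PiM I (\<lambda>_. borel :: (real^2) measure)). inj_on x I}"
  note sets_PiM_intensity_measure[measurable_cong]
  have O[measurable]: "?O \<in> sets (PiM I (\<lambda>_. borel))" by (rule sets_inj_on_PiM[OF I])
  have sets: "sets ?\<mu> = sets (PiM I (\<lambda>_. borel))" "sets ?\<pi> = sets (PiM I (\<lambda>_. borel))"
    by (simp_all add: tuple_measure_def sets_PiM_intensity_measure)
  have eq: "density ?\<mu> (indicator ?O) = density ?\<pi> (indicator ?O)"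
    by (rule measure_eqI) (auto simp: sets emeasure_restricted intro!: tuple_measure_eq_on_distinct P \<rho> I)
  have "AE \<omega> in M. inj (\<lambda>i. X i \<omega>)"
    using P by (simp add: poisson_pp_def)
  then have "AE \<omega> in M. (\<integral>\<^sup>+ s. (if inj_on s I then f (\<lambda>i\<in>I. X (s i) \<omega>) else 0) \<partial>PiM I (\<lambda>_. count_space UNIV))
      = (\<integral>\<^sup>+ s. indicator ?O (\<lambda>i\<in>I. X (s i) \<omega>) * f (\<lambda>i\<in>I. X (s i) \<omega>) \<partial>PiM I (\<lambda>_. count_space UNIV))"
  proof eventually_elim
    fix \<omega> assume inj: "inj (\<lambda>i. X i \<omega>)"
    have "inj_on s I \<longleftrightarrow> (\<lambda>i\<in>I. X (s i) \<omega>) \<in> ?O" for s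
      using inj by (auto simp: space_PiM inj_on_def)
    then show "(\<integral>\<^sup>+ s. (if inj_on s I then f (\<lambda>i\<in>I. X (s i) \<omega>) else 0) \<partial>PiM I (\<lambda>_. count_space UNIV))
      = (\<integral>\<^sup>+ s. indicator ?O (\<lambda>i\<in>I. X (s i) \<omega>) * f (\<lambda>i\<in>I. X (s i) \<omega>) \<partial>PiM I (\<lambda>_. count_space UNIV))"
      by (intro nn_integral_cong) (simp add: indicator_def)
  qed
  then have "(\<integral>\<^sup>+ \<omega>. (\<integral>\<^sup>+ s. (if inj_on s I then f (\<lambda>i\<in>I. X (s i) \<omega>) else 0)
            \<partial>PiM I (\<lambda>_. count_space UNIV)) \<partial>M)
      = (\<integral>\<^sup>+ \<omega>. (\<integral>\<^sup>+ s. indicator ?O (\<lambda>i\<in>I. X (s i) \<omega>) * f (\<lambda>i\<in>I. X (s i) \<omega>)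
            \<partial>PiM I (\<lambda>_. count_space UNIV)) \<partial>M)"
    by (rule nn_integral_cong_AE)
  also have "\<dots> = integral\<^sup>N ?\<mu> (\<lambda>x. indicator ?O x * f x)"
    by (intro nn_integral_tuple_measure[symmetric] I poisson_pp_measurable[OF P]) measurable
  also have "\<dots> = integral\<^sup>N (density ?\<mu> (indicator ?O)) f"
    by (subst nn_integral_density) (auto simp: measurable_cong_sets[OF sets(1) refl])
  also have "\<dots> = integral\<^sup>N ?\<pi> (\<lambda>x. indicator ?O x * f x)"
    unfolding eq by (subst nn_integral_density) (auto simp: measurable_cong_sets[OF sets(2) refl])
  also have "\<dots> = integral\<^sup>N ?\<pi> f"
  proof (rule nn_integral_cong_AE)
    show "AE x in ?\<pi>. indicator ?O x * f x = f x"
      using AE_PiM_intensity_measure_inj_on[OF I, of \<rho>] AE_space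
      by eventually_elim (simp add: space_PiM)
  qed
  finally show ?thesis .
qed

end

section \<open>Product integrals as iterated integrals\<close>

context product_sigma_finite
begin

text \<open>Peels off the coordinate i. The last hypothesis says that g reads this coordinate only
  through its first argument, so the update \<open>x(i := a)\<close> produced by the insertion rule
  disappears.\<close>

lemma nn_integral_PiM_insert:
  fixes J :: "'i set"
  assumes "finite J" "i \<notin> J"
    and "(\<lambda>x. g (x i) x) \<in> borel_measurable (PiM (insert i J) M)"
    and "\<And>a x. g a (x(i := a)) = g a x"
  shows "(\<integral>\<^sup>+ x. g (x i) x \<partial>PiM (insert i J) M) = (\<integral>\<^sup>+ a. (\<integral>\<^sup>+ x. g a x \<partial>PiM J M) \<partial>M i)"
  using assms by (subst product_nn_integral_insert_rev) simp_all

text \<open>This and the two lemmas after it serve both sides of the Campbell formula: with counting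
  measures they unfold the sum over index tuples, with the intensity measure the integral over
  points.\<close>

lemma nn_integral_PiM_pair:
  assumes ij: "i \<noteq> j" and f: "(\<lambda>(a, b). f a b) \<in> borel_measurable (M i \<Otimes>\<^sub>M M j)"
  shows "(\<integral>\<^sup>+ x. f (x i) (x j) \<partial>PiM {i, j} M) = (\<integral>\<^sup>+ a. \<integral>\<^sup>+ b. f a b \<partial>M j \<partial>M i)"
proof -
  have "(\<lambda>x. (\<lambda>(a, b). f a b) (x i, x j)) \<in> borel_measurable (PiM {i, j} M)"
    by (rule measurable_compose[OF _ f]) simp
  then have "(\<integral>\<^sup>+ x. f (x i) (x j) \<partial>PiM {i, j} M) = (\<integral>\<^sup>+ a. (\<integral>\<^sup>+ x. f a (x j) \<partial>PiM {j} M) \<partial>M i)"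
    using ij by (intro nn_integral_PiM_insert[where g="\<lambda>a x. f a (x j)"]) auto
  also have "\<dots> = (\<integral>\<^sup>+ a. \<integral>\<^sup>+ b. f a b \<partial>M j \<partial>M i)"
  proof (rule nn_integral_cong, rule product_nn_integral_singleton)
    fix a assume "a \<in> space (M i)"
    from measurable_compose[OF measurable_Pair1'[OF this] f] show "f a \<in> borel_measurable (M j)" by simp
  qed
  finally show ?thesis .
qed

lemma nn_integral_PiM_triple:
  assumes d: "distinct [i, j, k]" and f: "(\<lambda>(a, b, c). f a b c) \<in> borel_measurable (M i \<Otimes>\<^sub>M M j \<Otimes>\<^sub>M M k)"
  shows "(\<integral>\<^sup>+ x. f (x i) (x j) (x k) \<partial>PiM {i, j, k} M) = (\<integral>\<^sup>+ a. \<integral>\<^sup>+ b. \<integral>\<^sup>+ c. f a b c \<partial>M k \<partial>M j \<partial>M i)"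
proof -
  have "(\<lambda>x. (\<lambda>(a, b, c). f a b c) (x i, x j, x k)) \<in> borel_measurable (PiM {i, j, k} M)"
    by (rule measurable_compose[OF _ f]) simp
  then have "(\<integral>\<^sup>+ x. f (x i) (x j) (x k) \<partial>PiM {i, j, k} M)
      = (\<integral>\<^sup>+ a. (\<integral>\<^sup>+ x. f a (x j) (x k) \<partial>PiM {j, k} M) \<partial>M i)"
    using d by (intro nn_integral_PiM_insert[where g="\<lambda>a x. f a (x j) (x k)"]) auto
  also have "\<dots> = (\<integral>\<^sup>+ a. \<integral>\<^sup>+ b. \<integral>\<^sup>+ c. f a b c \<partial>M k \<partial>M j \<partial>M i)"
  proof (rule nn_integral_cong, rule nn_integral_PiM_pair)
    fix a assume "a \<in> space (M i)"
    from measurable_compose[OF measurable_Pair1'[OF this] f]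
    show "(\<lambda>(b, c). f a b c) \<in> borel_measurable (M j \<Otimes>\<^sub>M M k)" by (simp add: split_beta')
  qed (use d in simp)
  finally show ?thesis .
qed

lemma nn_integral_PiM_quadruple:
  assumes d: "distinct [i, j, k, l]"
    and f: "(\<lambda>(a, b, c, d). f a b c d) \<in> borel_measurable (M i \<Otimes>\<^sub>M M j \<Otimes>\<^sub>M M k \<Otimes>\<^sub>M M l)"
  shows "(\<integral>\<^sup>+ x. f (x i) (x j) (x k) (x l) \<partial>PiM {i, j, k, l} M)
       = (\<integral>\<^sup>+ a. \<integral>\<^sup>+ b. \<integral>\<^sup>+ c. \<integral>\<^sup>+ d. f a b c d \<partial>M l \<partial>M k \<partial>M j \<partial>M i)"
proof -
  have "(\<lambda>x. (\<lambda>(a, b, c, d). f a b c d) (x i, x j, x k, x l)) \<in> borel_measurable (PiM {i, j, k, l} M)"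
    by (rule measurable_compose[OF _ f]) simp
  then have "(\<integral>\<^sup>+ x. f (x i) (x j) (x k) (x l) \<partial>PiM {i, j, k, l} M)
      = (\<integral>\<^sup>+ a. (\<integral>\<^sup>+ x. f a (x j) (x k) (x l) \<partial>PiM {j, k, l} M) \<partial>M i)"
    using d by (intro nn_integral_PiM_insert[where g="\<lambda>a x. f a (x j) (x k) (x l)"]) auto
  also have "\<dots> = (\<integral>\<^sup>+ a. \<integral>\<^sup>+ b. \<integral>\<^sup>+ c. \<integral>\<^sup>+ d. f a b c d \<partial>M l \<partial>M k \<partial>M j \<partial>M i)"
  proof (rule nn_integral_cong, rule nn_integral_PiM_triple)
    fix a assume "a \<in> space (M i)"
    from measurable_compose[OF measurable_Pair1'[OF this] f]
    show "(\<lambda>(b, c, d). f a b c d) \<in> borel_measurable (M j \<Otimes>\<^sub>M M k \<Otimes>\<^sub>M M l)" by (simp add: split_beta')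
  qed (use d in simp)
  finally show ?thesis .
qed

end

section \<open>The Campbell formula for two, three and four points\<close>

context prob_space
begin

lemma campbell_pair:
  assumes P: "poisson_pp \<rho> X" and \<rho>: "\<rho> > 0"
    and f[measurable]: "(\<lambda>(a, b). f a b) \<in> borel_measurable (borel \<Otimes>\<^sub>M borel)"
  shows "(\<integral>\<^sup>+ \<omega>. (\<integral>\<^sup>+ i. \<integral>\<^sup>+ j. (if distinct [i, j] then f (X i \<omega>) (X j \<omega>) else 0)
            \<partial>count_space UNIV \<partial>count_space UNIV) \<partial>M)
       = (\<integral>\<^sup>+ a. \<integral>\<^sup>+ b. f a b \<partial>intensity_measure \<rho> \<partial>intensity_measure \<rho>)"
proof -
  interpret N: product_sigma_finite "\<lambda>_::nat. count_space (UNIV :: nat set)"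
    by (intro product_sigma_finite.intro sigma_finite_measure_count_space)
  interpret R: product_sigma_finite "\<lambda>_::nat. intensity_measure \<rho>"
    by (intro product_sigma_finite.intro sigma_finite_intensity_measure)
  let ?I = "{0, 1} :: nat set"
  have m: "(\<lambda>x. f (x 0) (x 1)) \<in> borel_measurable (PiM ?I (\<lambda>_. borel))" by measurable
  have "(\<integral>\<^sup>+ \<omega>. (\<integral>\<^sup>+ i. \<integral>\<^sup>+ j. (if distinct [i, j] then f (X i \<omega>) (X j \<omega>) else 0)
            \<partial>count_space UNIV \<partial>count_space UNIV) \<partial>M)
      = (\<integral>\<^sup>+ \<omega>. (\<integral>\<^sup>+ s. (if inj_on s ?I then f ((\<lambda>i\<in>?I. X (s i) \<omega>) 0) ((\<lambda>i\<in>?I. X (s i) \<omega>) 1) else 0)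
            \<partial>PiM ?I (\<lambda>_. count_space UNIV)) \<partial>M)"
    \<comment> \<open>The product of the two counting measures on \<open>nat\<close> is again a
      counting measure, so the measurability condition is trivial.\<close>
    by (intro nn_integral_cong, subst N.nn_integral_PiM_pair[symmetric, of 0 1])
      (auto simp: pair_measure_countable intro!: nn_integral_cong)
  also have "\<dots> = (\<integral>\<^sup>+ x. f (x 0) (x 1) \<partial>PiM ?I (\<lambda>_. intensity_measure \<rho>))"
    by (rule poisson_pp_multivariate_campbell[OF P \<rho> _ m]) simp
  also have "\<dots> = (\<integral>\<^sup>+ a. \<integral>\<^sup>+ b. f a b \<partial>intensity_measure \<rho> \<partial>intensity_measure \<rho>)"
    by (rule R.nn_integral_PiM_pair) simp_all
  finally show ?thesis .
qed

lemma campbell_triple: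
  assumes P: "poisson_pp \<rho> X" and \<rho>: "\<rho> > 0"
    and f[measurable]: "(\<lambda>(a, b, c). f a b c) \<in> borel_measurable (borel \<Otimes>\<^sub>M borel \<Otimes>\<^sub>M borel)"
  shows "(\<integral>\<^sup>+ \<omega>. (\<integral>\<^sup>+ i. \<integral>\<^sup>+ j. \<integral>\<^sup>+ k. (if distinct [i, j, k] then f (X i \<omega>) (X j \<omega>) (X k \<omega>) else 0)
            \<partial>count_space UNIV \<partial>count_space UNIV \<partial>count_space UNIV) \<partial>M)
       = (\<integral>\<^sup>+ a. \<integral>\<^sup>+ b. \<integral>\<^sup>+ c. f a b c \<partial>intensity_measure \<rho> \<partial>intensity_measure \<rho> \<partial>intensity_measure \<rho>)"
proof -
  interpret N: product_sigma_finite "\<lambda>_::nat. count_space (UNIV :: nat set)"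
    by (intro product_sigma_finite.intro sigma_finite_measure_count_space)
  interpret R: product_sigma_finite "\<lambda>_::nat. intensity_measure \<rho>"
    by (intro product_sigma_finite.intro sigma_finite_intensity_measure)
  let ?I = "{0, 1, 2} :: nat set"
  have m: "(\<lambda>x. f (x 0) (x 1) (x 2)) \<in> borel_measurable (PiM ?I (\<lambda>_. borel))"
    using measurable_compose[OF _ f, of "\<lambda>x. (x 0, x 1, x 2)" "PiM ?I (\<lambda>_. borel)"] by simp
  have "(\<integral>\<^sup>+ \<omega>. (\<integral>\<^sup>+ i. \<integral>\<^sup>+ j. \<integral>\<^sup>+ k. (if distinct [i, j, k] then f (X i \<omega>) (X j \<omega>) (X k \<omega>) else 0)
            \<partial>count_space UNIV \<partial>count_space UNIV \<partial>count_space UNIV) \<partial>M)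
      = (\<integral>\<^sup>+ \<omega>. (\<integral>\<^sup>+ s. (if inj_on s ?I then f ((\<lambda>i\<in>?I. X (s i) \<omega>) 0) ((\<lambda>i\<in>?I. X (s i) \<omega>) 1)
            ((\<lambda>i\<in>?I. X (s i) \<omega>) 2) else 0)
            \<partial>PiM ?I (\<lambda>_. count_space UNIV)) \<partial>M)"
    by (intro nn_integral_cong, subst N.nn_integral_PiM_triple[symmetric, of 0 1 2])
      (auto simp: pair_measure_countable intro!: nn_integral_cong)
  also have "\<dots> = (\<integral>\<^sup>+ x. f (x 0) (x 1) (x 2) \<partial>PiM ?I (\<lambda>_. intensity_measure \<rho>))"
    by (rule poisson_pp_multivariate_campbell[OF P \<rho> _ m]) simp
  also have "\<dots> = (\<integral>\<^sup>+ a. \<integral>\<^sup>+ b. \<integral>\<^sup>+ c. f a b c \<partial>intensity_measure \<rho> \<partial>intensity_measure \<rho> \<partial>intensity_measure \<rho>)"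
    by (rule R.nn_integral_PiM_triple) simp_all
  finally show ?thesis .
qed

lemma campbell_quadruple:
  assumes P: "poisson_pp \<rho> X" and \<rho>: "\<rho> > 0"
    and f[measurable]: "(\<lambda>(a, b, c, d). f a b c d) \<in> borel_measurable (borel \<Otimes>\<^sub>M borel \<Otimes>\<^sub>M borel \<Otimes>\<^sub>M borel)"
  shows "(\<integral>\<^sup>+ \<omega>. (\<integral>\<^sup>+ i. \<integral>\<^sup>+ j. \<integral>\<^sup>+ k. \<integral>\<^sup>+ l.
            (if distinct [i, j, k, l] then f (X i \<omega>) (X j \<omega>) (X k \<omega>) (X l \<omega>) else 0)
            \<partial>count_space UNIV \<partial>count_space UNIV \<partial>count_space UNIV \<partial>count_space UNIV) \<partial>M)
       = (\<integral>\<^sup>+ a. \<integral>\<^sup>+ b. \<integral>\<^sup>+ c. \<integral>\<^sup>+ d. f a b c d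
            \<partial>intensity_measure \<rho> \<partial>intensity_measure \<rho> \<partial>intensity_measure \<rho> \<partial>intensity_measure \<rho>)"
proof -
  interpret N: product_sigma_finite "\<lambda>_::nat. count_space (UNIV :: nat set)"
    by (intro product_sigma_finite.intro sigma_finite_measure_count_space)
  interpret R: product_sigma_finite "\<lambda>_::nat. intensity_measure \<rho>"
    by (intro product_sigma_finite.intro sigma_finite_intensity_measure)
  let ?I = "{0, 1, 2, 3} :: nat set"
  have m: "(\<lambda>x. f (x 0) (x 1) (x 2) (x 3)) \<in> borel_measurable (PiM ?I (\<lambda>_. borel))"
    using measurable_compose[OF _ f, of "\<lambda>x. (x 0, x 1, x 2, x 3)" "PiM ?I (\<lambda>_. borel)"] by simp
  have "(\<integral>\<^sup>+ \<omega>. (\<integral>\<^sup>+ i. \<integral>\<^sup>+ j. \<integral>\<^sup>+ k. \<integral>\<^sup>+ l.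
            (if distinct [i, j, k, l] then f (X i \<omega>) (X j \<omega>) (X k \<omega>) (X l \<omega>) else 0)
            \<partial>count_space UNIV \<partial>count_space UNIV \<partial>count_space UNIV \<partial>count_space UNIV) \<partial>M)
      = (\<integral>\<^sup>+ \<omega>. (\<integral>\<^sup>+ s. (if inj_on s ?I then f ((\<lambda>i\<in>?I. X (s i) \<omega>) 0) ((\<lambda>i\<in>?I. X (s i) \<omega>) 1)
            ((\<lambda>i\<in>?I. X (s i) \<omega>) 2) ((\<lambda>i\<in>?I. X (s i) \<omega>) 3) else 0)
            \<partial>PiM ?I (\<lambda>_. count_space UNIV)) \<partial>M)"
    by (intro nn_integral_cong, subst N.nn_integral_PiM_quadruple[symmetric, of 0 1 2 3])
      (auto simp: pair_measure_countable intro!: nn_integral_cong)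
  also have "\<dots> = (\<integral>\<^sup>+ x. f (x 0) (x 1) (x 2) (x 3) \<partial>PiM ?I (\<lambda>_. intensity_measure \<rho>))"
    by (rule poisson_pp_multivariate_campbell[OF P \<rho> _ m]) simp
  also have "\<dots> = (\<integral>\<^sup>+ a. \<integral>\<^sup>+ b. \<integral>\<^sup>+ c. \<integral>\<^sup>+ d. f a b c d
            \<partial>intensity_measure \<rho> \<partial>intensity_measure \<rho> \<partial>intensity_measure \<rho> \<partial>intensity_measure \<rho>)"
    by (rule R.nn_integral_PiM_quadruple) simp_all
  finally show ?thesis .
qed

end

section \<open>Averaging over the marks\<close>

context prob_space
begin

lemma nn_integral_uniform_less:
  assumes "distributed M lborel V (indicator {0..1})" "0 \<le> c" "c \<le> 1"
  shows "(\<integral>\<^sup>+ \<omega>. indicator {..<c} (V \<omega>) \<partial>M) = ennreal c"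
proof -
  have "(\<integral>\<^sup>+ \<omega>. indicator {..<c} (V \<omega>) \<partial>M) = (\<integral>\<^sup>+ t. indicator {0..1} t * indicator {..<c} t \<partial>lborel)"
    by (rule distributed_nn_integral[symmetric, OF assms(1)]) simp
  also have "\<dots> = (\<integral>\<^sup>+ t. indicator {0..<c} t \<partial>lborel)"
    using assms by (intro nn_integral_cong) (auto split: split_indicator)
  finally show ?thesis using assms by simp
qed

text \<open>For a frozen configuration Z the thresholds \<open>h k Z\<close> are constants, and
  independent uniform marks fall below them with probability the product of the thresholds.
  Independence of marks and points justifies the freezing. As K is a set, every mark contributes one
  factor only.\<close>

lemma rcm_marks_nn_integral:
  assumes R: "rcm_marks X U" and X: "(\<lambda>\<omega> i. X i \<omega>) \<in> measurable M (PiM UNIV (\<lambda>_. borel))"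
    and K: "finite K"
    and h[measurable]: "\<And>k. h k \<in> borel_measurable (PiM UNIV (\<lambda>_. borel))"
    and h01: "\<And>k Z. 0 \<le> h k Z" "\<And>k Z. h k Z \<le> 1"
  shows "(\<integral>\<^sup>+ \<omega>. (\<Prod>k\<in>K. indicator {..<h k (\<lambda>i. X i \<omega>)} (U k \<omega>)) \<partial>M)
       = (\<integral>\<^sup>+ \<omega>. (\<Prod>k\<in>K. ennreal (h k (\<lambda>i. X i \<omega>))) \<partial>M)"
proof -
  let ?S = "PiM UNIV (\<lambda>_. borel) :: (nat \<Rightarrow> real^2) measure" and ?T = "PiM UNIV (\<lambda>_. borel) :: (mark_idx \<Rightarrow> real) measure"
  let ?X = "\<lambda>\<omega> i. X i \<omega>" and ?U = "\<lambda>\<omega> k. U k \<omega>"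
  have U: "?U \<in> measurable M ?T" and ind: "indep_vars (\<lambda>_. borel) U UNIV"
    and unif: "\<And>k. distributed M lborel (U k) (indicator {0..1})"
    using R by (auto simp: rcm_marks_def)
  note [measurable] = X U
  interpret PX: prob_space "distr M ?S ?X" by (rule prob_space_distr[OF X])
  interpret PU: prob_space "distr M ?T ?U" by (rule prob_space_distr[OF U])
  \<comment> \<open>Independence of the two generated sigma-algebras, tested on rectangles, says
    that the joint law of points and marks is a product; Tonelli then integrates the marks
    first.\<close>
  have D: "distr M (?S \<Otimes>\<^sub>M ?T) (\<lambda>\<omega>. (?X \<omega>, ?U \<omega>)) = distr M ?S ?X \<Otimes>\<^sub>M distr M ?T ?U"
  proof (rule pair_measure_eqI[symmetric])
    fix A B assume "A \<in> sets (distr M ?S ?X)" "B \<in> sets (distr M ?T ?U)"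
    then have [measurable]: "A \<in> sets ?S" "B \<in> sets ?T" by auto
    have "indep_set (sigma_sets (space M) {?X -` A \<inter> space M | A. A \<in> sets ?S})
        (sigma_sets (space M) {?U -` A \<inter> space M | A. A \<in> sets ?T})"
      using R by (simp add: rcm_marks_def)
    then have "prob ((?X -` A \<inter> space M) \<inter> (?U -` B \<inter> space M))
        = prob (?X -` A \<inter> space M) * prob (?U -` B \<inter> space M)"
      by (rule indep_setD) (rule sigma_sets.Basic, use \<open>A \<in> sets ?S\<close> \<open>B \<in> sets ?T\<close> in blast)+
    moreover have "(\<lambda>\<omega>. (?X \<omega>, ?U \<omega>)) -` (A \<times> B) \<inter> space M = (?X -` A \<inter> space M) \<inter> (?U -` B \<inter> space M)"
      by auto
    ultimately show "emeasure (distr M ?S ?X) A * emeasure (distr M ?T ?U) B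
        = emeasure (distr M (?S \<Otimes>\<^sub>M ?T) (\<lambda>\<omega>. (?X \<omega>, ?U \<omega>))) (A \<times> B)"
      by (simp add: emeasure_distr emeasure_eq_measure flip: ennreal_mult)
  qed (simp_all add: PX.sigma_finite_measure_axioms PU.sigma_finite_measure_axioms cong: sets_pair_measure_cong)
  define F where "F p = (\<Prod>k\<in>K. indicator {t. t < h k (fst p)} (snd p k) :: ennreal)" for p
  have F[measurable]: "F \<in> borel_measurable (?S \<Otimes>\<^sub>M ?T)"
    unfolding F_def indicator_def by measurable
  have inner: "(\<integral>\<^sup>+ \<omega>. (\<Prod>k\<in>K. indicator {t. t < h k Z} (U k \<omega>)) \<partial>M) = (\<Prod>k\<in>K. ennreal (h k Z))" for Z
  proof -
    have "indep_vars (\<lambda>_. borel) (\<lambda>k \<omega>. indicator {t. t < h k Z} (U k \<omega>) :: ennreal) K"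
      by (rule indep_vars_compose2[OF indep_vars_subset[OF ind subset_UNIV]]) measurable
    then have "(\<integral>\<^sup>+ \<omega>. (\<Prod>k\<in>K. indicator {t. t < h k Z} (U k \<omega>)) \<partial>M)
        = (\<Prod>k\<in>K. \<integral>\<^sup>+ \<omega>. indicator {t. t < h k Z} (U k \<omega>) \<partial>M)"
      by (intro indep_vars_nn_integral K) auto
    then show ?thesis
      using nn_integral_uniform_less[OF unif h01] by (simp add: lessThan_def)
  qed
  have "(\<integral>\<^sup>+ \<omega>. (\<Prod>k\<in>K. indicator {..<h k (\<lambda>i. X i \<omega>)} (U k \<omega>)) \<partial>M) = (\<integral>\<^sup>+ \<omega>. F (?X \<omega>, ?U \<omega>) \<partial>M)"
    by (simp add: F_def lessThan_def)
  also have "\<dots> = integral\<^sup>N (distr M (?S \<Otimes>\<^sub>M ?T) (\<lambda>\<omega>. (?X \<omega>, ?U \<omega>))) F"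
    by (subst nn_integral_distr) simp_all
  also have "\<dots> = (\<integral>\<^sup>+ Z. (\<integral>\<^sup>+ u. F (Z, u) \<partial>distr M ?T ?U) \<partial>distr M ?S ?X)"
    unfolding D by (rule PU.nn_integral_fst[symmetric]) simp
  also have "\<dots> = (\<integral>\<^sup>+ Z. (\<Prod>k\<in>K. ennreal (h k Z)) \<partial>distr M ?S ?X)"
  proof (rule nn_integral_cong)
    fix Z assume "Z \<in> space (distr M ?S ?X)"
    then have "(\<lambda>u. F (Z, u)) \<in> borel_measurable ?T"
      by (intro measurable_compose[OF measurable_Pair1' F]) simp
    then have "(\<integral>\<^sup>+ u. F (Z, u) \<partial>distr M ?T ?U) = (\<integral>\<^sup>+ \<omega>. F (Z, ?U \<omega>) \<partial>M)"
      by (intro nn_integral_distr U) simp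
    then show "(\<integral>\<^sup>+ u. F (Z, u) \<partial>distr M ?T ?U) = (\<Prod>k\<in>K. ennreal (h k Z))"
      by (simp add: F_def inner)
  qed
  also have "\<dots> = (\<integral>\<^sup>+ \<omega>. (\<Prod>k\<in>K. ennreal (h k (\<lambda>i. X i \<omega>))) \<partial>M)"
    by (subst nn_integral_distr) simp_all
  finally show ?thesis .
qed

end

section \<open>Gaussian integrals\<close>

lemma nn_integral_gauss_real:
  fixes c :: real
  assumes c: "c > 0"
  shows "(\<integral>\<^sup>+ t. ennreal (exp (- c * t\<^sup>2)) \<partial>lborel) = ennreal (sqrt (pi / c))"
proof -
  \<comment> \<open>This standard deviation turns the normal exponent t^2 / (2 \<sigma>^2) into c
    t^2.\<close>
  define \<sigma> where "\<sigma> = 1 / sqrt (2 * c)"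
  have \<sigma>: "\<sigma> > 0" "\<sigma>\<^sup>2 = 1 / (2 * c)" using c by (simp_all add: \<sigma>_def power_divide)
  have "ennreal (exp (- c * t\<^sup>2)) = ennreal (sqrt (pi / c)) * ennreal (normal_density 0 \<sigma> t)" for t
    using c by (simp add: normal_density_def \<sigma> field_simps real_sqrt_divide flip: ennreal_mult)
  then have "(\<integral>\<^sup>+ t. ennreal (exp (- c * t\<^sup>2)) \<partial>lborel)
      = ennreal (sqrt (pi / c)) * (\<integral>\<^sup>+ t. ennreal (normal_density 0 \<sigma> t) \<partial>lborel)"
    by (simp add: nn_integral_cmult)
  also have "(\<integral>\<^sup>+ t. ennreal (normal_density 0 \<sigma> t) \<partial>lborel) = 1"
    using \<sigma>(1) by (subst nn_integral_eq_integral) simp_all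
  finally show ?thesis by simp
qed

lemma nn_integral_gauss_plane:
  fixes p :: "real^2"
  assumes c: "c > 0"
  shows "(\<integral>\<^sup>+ z. ennreal (exp (- c * (norm (z - p))\<^sup>2)) \<partial>lborel) = ennreal (pi / c)"
proof -
  have "(\<integral>\<^sup>+ z. ennreal (exp (- c * (norm (z - p))\<^sup>2)) \<partial>lborel)
      = (\<integral>\<^sup>+ z. ennreal (exp (- c * (norm (z :: real^2))\<^sup>2)) \<partial>lborel)"
    by (subst lborel_distr_plus[of p, symmetric], subst nn_integral_distr) simp_all
  also have "\<dots> = (\<integral>\<^sup>+ z. (\<Prod>b\<in>Basis. ennreal (exp (- c * ((z :: real^2) \<bullet> b)\<^sup>2))) \<partial>lborel)"
  proof (intro nn_integral_cong)
    fix z :: "real^2"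
    have "exp (- c * (norm z)\<^sup>2) = (\<Prod>b\<in>Basis. exp (- c * (z \<bullet> b)\<^sup>2))"
      unfolding power2_norm_eq_inner
      by (subst euclidean_inner) (simp add: sum_distrib_left exp_sum power2_eq_square flip: sum_negf)
    then show "ennreal (exp (- c * (norm z)\<^sup>2)) = (\<Prod>b\<in>Basis. ennreal (exp (- c * (z \<bullet> b)\<^sup>2)))"
      by (simp add: prod_ennreal)
  qed
  also have "\<dots> = (\<Prod>b\<in>(Basis :: (real^2) set). (\<integral>\<^sup>+ t. ennreal (exp (- c * t\<^sup>2)) \<partial>lborel))"
    by (rule nn_integral_lborel_prod) simp_all
  also have "\<dots> = ennreal (sqrt (pi / c)) ^ 2"
    by (simp only: nn_integral_gauss_real[OF c] prod_constant) simp
  also have "\<dots> = ennreal (pi / c)"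
    using c by (simp add: ennreal_power)
  finally show ?thesis .
qed

text \<open>Completing the square about the weighted centroid of p and q. Only the sum of the
  weights has to be positive, so one of them may be zero.\<close>

lemma weighted_sum_norm_squares:
  fixes p q z :: "'b::real_inner"
  assumes "a + b > 0"
  shows "a * (norm (z - p))\<^sup>2 + b * (norm (z - q))\<^sup>2
    = (a + b) * (norm (z - (a / (a + b)) *\<^sub>R p - (b / (a + b)) *\<^sub>R q))\<^sup>2 + a * b / (a + b) * (norm (p - q))\<^sup>2"
proof -
  \<comment> \<open>With normalised weights s and 1 - s the claim is a polynomial identity in inner
    products.\<close>
  define s where "s = a / (a + b)"
  have s: "b / (a + b) = 1 - s" "a = s * (a + b)" "b = (1 - s) * (a + b)"
    using assms by (simp_all add: s_def field_simps)
  have "a * (norm (z - p))\<^sup>2 + b * (norm (z - q))\<^sup>2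
      = (a + b) * (s * (norm (z - p))\<^sup>2 + (1 - s) * (norm (z - q))\<^sup>2)"
    by (subst s(2), subst s(3)) (simp add: algebra_simps)
  also have "s * (norm (z - p))\<^sup>2 + (1 - s) * (norm (z - q))\<^sup>2
      = (norm (z - s *\<^sub>R p - (1 - s) *\<^sub>R q))\<^sup>2 + s * (1 - s) * (norm (p - q))\<^sup>2"
  proof -
    define u v where "u = z - p" and "v = z - q"
    have "z - s *\<^sub>R p - (1 - s) *\<^sub>R q = s *\<^sub>R u + (1 - s) *\<^sub>R v" "p - q = v - u"
      by (simp_all add: u_def v_def algebra_simps)
    moreover have "s * (norm u)\<^sup>2 + (1 - s) * (norm v)\<^sup>2
        = (norm (s *\<^sub>R u + (1 - s) *\<^sub>R v))\<^sup>2 + s * (1 - s) * (norm (v - u))\<^sup>2"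
      unfolding power2_norm_eq_inner
        inner_add_left inner_add_right inner_diff_left inner_diff_right inner_scaleR_left inner_scaleR_right
        inner_commute[of v u]
      by algebra
    ultimately show ?thesis by (simp add: u_def v_def)
  qed
  also have "(a + b) * ((norm (z - s *\<^sub>R p - (1 - s) *\<^sub>R q))\<^sup>2 + s * (1 - s) * (norm (p - q))\<^sup>2)
     = (a + b) * (norm (z - s *\<^sub>R p - (1 - s) *\<^sub>R q))\<^sup>2 + a * b / (a + b) * (norm (p - q))\<^sup>2"
  proof -
    have "(a + b) * (s * (1 - s)) = a * b / (a + b)"
      using assms unfolding s(1)[symmetric] by (simp add: s_def)
    then show ?thesis by (simp add: distrib_left flip: mult.assoc)
  qed
  finally show ?thesis by (simp only: s(1)[symmetric] s_def[symmetric])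
qed

lemma nn_integral_gauss_two_centers:
  fixes p q :: "real^2"
  assumes "a + b > 0"
  shows "(\<integral>\<^sup>+ z. ennreal (exp (- (a * (norm (z - p))\<^sup>2 + b * (norm (z - q))\<^sup>2))) \<partial>lborel)
       = ennreal (pi / (a + b) * exp (- (a * b / (a + b)) * (norm (p - q))\<^sup>2))"
proof -
  let ?m = "(a / (a + b)) *\<^sub>R p + (b / (a + b)) *\<^sub>R q" and ?E = "exp (- (a * b / (a + b)) * (norm (p - q))\<^sup>2)"
  have "ennreal (exp (- (a * (norm (z - p))\<^sup>2 + b * (norm (z - q))\<^sup>2)))
      = ennreal ?E * ennreal (exp (- (a + b) * (norm (z - ?m))\<^sup>2))" for z
    unfolding weighted_sum_norm_squares[OF assms]
    by (simp add: exp_add[symmetric] algebra_simps flip: ennreal_mult)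
  then have "(\<integral>\<^sup>+ z. ennreal (exp (- (a * (norm (z - p))\<^sup>2 + b * (norm (z - q))\<^sup>2))) \<partial>lborel)
      = ennreal ?E * (\<integral>\<^sup>+ z. ennreal (exp (- (a + b) * (norm (z - ?m))\<^sup>2)) \<partial>lborel)"
    by (simp add: nn_integral_cmult)
  also have "\<dots> = ennreal ?E * ennreal (pi / (a + b))"
    by (subst nn_integral_gauss_plane[OF assms]) simp
  finally show ?thesis
    using assms by (simp add: mult.commute flip: ennreal_mult)
qed

section \<open>Pairs of paths\<close>

lemma nn_integral_count_pair:
  "(\<integral>\<^sup>+ q. f (fst q) (snd q) \<partial>count_space UNIV) = (\<integral>\<^sup>+ i. \<integral>\<^sup>+ j. f i j \<partial>count_space UNIV \<partial>count_space UNIV)"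
  using nn_integral_fst_count_space[of "\<lambda>q. f (fst q) (snd q)"] by simp

definition edge_mark :: "nat \<Rightarrow> nat \<Rightarrow> mark_idx" where
  "edge_mark i j = Ue (min i j) (max i j)"

text \<open>Decides when two paths share a middle edge: a path and its reversal do, since edges are
  undirected.\<close>

lemma edge_mark_eq_iff: "edge_mark i j = edge_mark k l \<longleftrightarrow> i = k \<and> j = l \<or> i = l \<and> j = k"
  by (auto simp: edge_mark_def min_def max_def)

lemma edge_mark_neq [simp]:
  "edge_mark i j \<noteq> Ux k" "edge_mark i j \<noteq> Uy k" "Ux k \<noteq> edge_mark i j" "Uy k \<noteq> edge_mark i j"
  by (simp_all add: edge_mark_def)

text \<open>Collects the thresholds of all three kinds of marks into one function of mark and
  configuration, the shape of \<open>h\<close> in \<open>rcm_marks_nn_integral\<close>.\<close>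

fun conn_prob :: "real \<Rightarrow> real^2 \<Rightarrow> real^2 \<Rightarrow> mark_idx \<Rightarrow> (nat \<Rightarrow> real^2) \<Rightarrow> real" where
  "conn_prob \<beta> x y (Ux i) Z = gaussH \<beta> (norm (x - Z i))"
| "conn_prob \<beta> x y (Ue i j) Z = gaussH \<beta> (norm (Z i - Z j))"
| "conn_prob \<beta> x y (Uy j) Z = gaussH \<beta> (norm (Z j - y))"

lemma conn_prob_edge_mark [simp]: "conn_prob \<beta> x y (edge_mark i j) Z = gaussH \<beta> (norm (Z i - Z j))"
  by (auto simp: edge_mark_def min_def max_def norm_minus_commute)

lemma gaussH_bounds: "0 \<le> gaussH \<beta> r" "\<beta> > 0 \<Longrightarrow> gaussH \<beta> r \<le> 1"
  by (simp_all add: gaussH_def)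

lemma gaussH_measurable [measurable]: "gaussH \<beta> \<in> borel_measurable borel"
  unfolding gaussH_def by measurable

lemma conn_prob_bounds: "0 \<le> conn_prob \<beta> x y k Z" "\<beta> > 0 \<Longrightarrow> conn_prob \<beta> x y k Z \<le> 1"
  by (cases k; simp add: gaussH_bounds)+

lemma conn_prob_measurable [measurable]:
  "conn_prob \<beta> x y k \<in> borel_measurable (PiM UNIV (\<lambda>_. borel))"
proof -
  have "(\<lambda>Z. conn_prob \<beta> x y k Z) \<in> borel_measurable (PiM UNIV (\<lambda>_. borel))"
    by (cases k) simp_all
  then show ?thesis by simp
qed

text \<open>A set, so that an edge common to two paths occurs once in their union.\<close>

definition path_marks :: "nat \<Rightarrow> nat \<Rightarrow> mark_idx set" where
  "path_marks i j = {Ux i, edge_mark i j, Uy j}"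

definition marks_open :: "real \<Rightarrow> real^2 \<Rightarrow> real^2 \<Rightarrow> (nat \<Rightarrow> 'a \<Rightarrow> real^2) \<Rightarrow> (mark_idx \<Rightarrow> 'a \<Rightarrow> real)
    \<Rightarrow> mark_idx set \<Rightarrow> 'a \<Rightarrow> ennreal" where
  "marks_open \<beta> x y X U K \<omega> = (\<Prod>k\<in>K. indicator {..<conn_prob \<beta> x y k (\<lambda>i. X i \<omega>)} (U k \<omega>))"

text \<open>For finite K this is the conditional probability, given the points Z, that all edges in
  K are present.\<close>

definition marks_weight :: "real \<Rightarrow> real^2 \<Rightarrow> real^2 \<Rightarrow> (nat \<Rightarrow> real^2) \<Rightarrow> mark_idx set \<Rightarrow> ennreal" where
  "marks_weight \<beta> x y Z K = (\<Prod>k\<in>K. ennreal (conn_prob \<beta> x y k Z))"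

lemma marks_open_eq_if:
  assumes "finite K"
  shows "marks_open \<beta> x y X U K \<omega> = (if \<forall>k\<in>K. U k \<omega> < conn_prob \<beta> x y k (\<lambda>i. X i \<omega>) then 1 else 0)"
  using assms by (induction K) (auto simp: marks_open_def)

text \<open>Indicators are idempotent, so a shared edge counts once. Averaging must come after this
  merging, as otherwise a shared edge would contribute its probability squared.\<close>

lemma marks_open_Un:
  assumes "finite K" "finite L"
  shows "marks_open \<beta> x y X U (K \<union> L) \<omega> = marks_open \<beta> x y X U K \<omega> * marks_open \<beta> x y X U L \<omega>"
  using assms by (auto simp: marks_open_eq_if)

lemma finite_path_marks [simp]: "finite (path_marks i j)"
  by (simp add: path_marks_def)

text \<open>Unlike \<^const>\<open>sigma3\<close>, this is infinite if there are infinitely many paths.\<close>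

definition num_paths :: "real \<Rightarrow> real^2 \<Rightarrow> real^2 \<Rightarrow> (nat \<Rightarrow> 'a \<Rightarrow> real^2) \<Rightarrow> (mark_idx \<Rightarrow> 'a \<Rightarrow> real)
    \<Rightarrow> 'a \<Rightarrow> ennreal" where
  "num_paths \<beta> x y X U \<omega> = (\<integral>\<^sup>+ p. (if fst p \<noteq> snd p then marks_open \<beta> x y X U (path_marks (fst p) (snd p)) \<omega> else 0)
     \<partial>count_space UNIV)"

text \<open>For infinitely many paths both sides take their default value 0: \<open>card\<close> of
  an infinite set and \<open>enn2real\<close> of infinity.\<close>

lemma sigma3_eq_num_paths: "sigma3 \<beta> x y X U \<omega> = enn2real (num_paths \<beta> x y X U \<omega>)"
proof -
  let ?P = "{(i, j). i \<noteq> j \<and>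
      U (Ux i) \<omega> < gaussH \<beta> (norm (x - X i \<omega>)) \<and>
      edge_pts \<beta> U X i j \<omega> \<and>
      U (Uy j) \<omega> < gaussH \<beta> (norm (X j \<omega> - y))}"
  have "num_paths \<beta> x y X U \<omega> = (\<integral>\<^sup>+ p. indicator ?P p \<partial>count_space UNIV)"
    unfolding num_paths_def
    by (intro nn_integral_cong)
      (auto simp: marks_open_eq_if path_marks_def edge_pts_def edge_mark_def[symmetric] split: split_indicator)
  then have "num_paths \<beta> x y X U \<omega> = emeasure (count_space UNIV) ?P"
    by simp
  then show ?thesis
    by (cases "finite ?P") (simp_all add: sigma3_def)
qed

lemma num_paths_square:
  "(num_paths \<beta> x y X U \<omega>)\<^sup>2 = (\<integral>\<^sup>+ q. (if fst (fst q) \<noteq> snd (fst q) \<and> fst (snd q) \<noteq> snd (snd q)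
      then marks_open \<beta> x y X U (path_marks (fst (fst q)) (snd (fst q)) \<union> path_marks (fst (snd q)) (snd (snd q))) \<omega>
      else 0) \<partial>count_space UNIV)"
proof -
  let ?t = "\<lambda>p. if fst p \<noteq> snd p then marks_open \<beta> x y X U (path_marks (fst p) (snd p)) \<omega> else 0"
  have "(num_paths \<beta> x y X U \<omega>)\<^sup>2 = (\<integral>\<^sup>+ p. \<integral>\<^sup>+ q. ?t p * ?t q \<partial>count_space UNIV \<partial>count_space UNIV)"
    unfolding num_paths_def power2_eq_square by (simp add: nn_integral_cmult nn_integral_multc)
  also have "\<dots> = (\<integral>\<^sup>+ q. ?t (fst q) * ?t (snd q) \<partial>count_space UNIV)"
    by (rule nn_integral_count_pair[where f="\<lambda>p q. ?t p * ?t q", symmetric])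
  also have "\<dots> = (\<integral>\<^sup>+ q. (if fst (fst q) \<noteq> snd (fst q) \<and> fst (snd q) \<noteq> snd (snd q)
      then marks_open \<beta> x y X U (path_marks (fst (fst q)) (snd (fst q)) \<union> path_marks (fst (snd q)) (snd (snd q))) \<omega>
      else 0) \<partial>count_space UNIV)"
    by (intro nn_integral_cong) (simp add: marks_open_Un)
  finally show ?thesis .
qed

context prob_space
begin

text \<open>The condition \<open>Q\<close> and the mark sets \<open>K\<close> depend on the indices
  alone, not on the outcome, so Tonelli permits averaging each term separately over the
  marks.\<close>

lemma rcm_marks_sum:
  fixes K :: "'k::countable \<Rightarrow> mark_idx set"
  assumes R: "rcm_marks X U" and P: "poisson_pp \<rho> X" and \<beta>: "\<beta> > 0" and K: "\<And>q. finite (K q)"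
  shows "(\<integral>\<^sup>+ \<omega>. (\<integral>\<^sup>+ q. (if Q q then marks_open \<beta> x y X U (K q) \<omega> else 0) \<partial>count_space UNIV) \<partial>M)
       = (\<integral>\<^sup>+ \<omega>. (\<integral>\<^sup>+ q. (if Q q then marks_weight \<beta> x y (\<lambda>i. X i \<omega>) (K q) else 0) \<partial>count_space UNIV) \<partial>M)"
    and "(\<lambda>\<omega>. \<integral>\<^sup>+ q. (if Q q then marks_open \<beta> x y X U (K q) \<omega> else 0) \<partial>count_space UNIV) \<in> borel_measurable M"
proof -
  have X[measurable]: "(\<lambda>\<omega> i. X i \<omega>) \<in> measurable M (PiM UNIV (\<lambda>_. borel))"
    using P by (simp add: poisson_pp_def)
  have "U k \<in> borel_measurable M" for k
  proof -
    have "(\<lambda>\<omega> k. U k \<omega>) \<in> measurable M (PiM UNIV (\<lambda>_. borel))"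
      using R by (simp add: rcm_marks_def)
    from measurable_compose[OF this measurable_component_singleton[of k UNIV]] show ?thesis by simp
  qed
  note [measurable] = this
  have c[measurable]: "(\<lambda>\<omega>. conn_prob \<beta> x y k (\<lambda>i. X i \<omega>)) \<in> borel_measurable M" for k
    by (rule measurable_compose[OF X conn_prob_measurable])
  have [measurable]: "marks_open \<beta> x y X U (K q) \<in> borel_measurable M" for q
    unfolding marks_open_eq_if[OF K, abs_def] using K by measurable
  have [measurable]: "(\<lambda>\<omega>. marks_weight \<beta> x y (\<lambda>i. X i \<omega>) (K q)) \<in> borel_measurable M" for q
    unfolding marks_weight_def by measurable
  have "(\<integral>\<^sup>+ \<omega>. marks_open \<beta> x y X U (K q) \<omega> \<partial>M) = (\<integral>\<^sup>+ \<omega>. marks_weight \<beta> x y (\<lambda>i. X i \<omega>) (K q) \<partial>M)" for q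
    unfolding marks_open_def marks_weight_def
    by (rule rcm_marks_nn_integral[OF R X K]) (use \<beta> conn_prob_bounds in auto)
  then have eq: "(\<integral>\<^sup>+ \<omega>. (if Q q then marks_open \<beta> x y X U (K q) \<omega> else 0) \<partial>M)
      = (\<integral>\<^sup>+ \<omega>. (if Q q then marks_weight \<beta> x y (\<lambda>i. X i \<omega>) (K q) else 0) \<partial>M)" for q
    by (cases "Q q") simp_all
  have "(\<integral>\<^sup>+ \<omega>. (\<integral>\<^sup>+ q. (if Q q then marks_open \<beta> x y X U (K q) \<omega> else 0) \<partial>count_space UNIV) \<partial>M)
      = (\<integral>\<^sup>+ q. (\<integral>\<^sup>+ \<omega>. (if Q q then marks_open \<beta> x y X U (K q) \<omega> else 0) \<partial>M) \<partial>count_space UNIV)"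
    by (rule nn_integral_count_space_nn_integral) simp_all
  also have "\<dots> = (\<integral>\<^sup>+ \<omega>. (\<integral>\<^sup>+ q. (if Q q then marks_weight \<beta> x y (\<lambda>i. X i \<omega>) (K q) else 0) \<partial>count_space UNIV) \<partial>M)"
    unfolding eq by (rule nn_integral_count_space_nn_integral[symmetric]) simp_all
  finally show "(\<integral>\<^sup>+ \<omega>. (\<integral>\<^sup>+ q. (if Q q then marks_open \<beta> x y X U (K q) \<omega> else 0) \<partial>count_space UNIV) \<partial>M)
       = (\<integral>\<^sup>+ \<omega>. (\<integral>\<^sup>+ q. (if Q q then marks_weight \<beta> x y (\<lambda>i. X i \<omega>) (K q) else 0) \<partial>count_space UNIV) \<partial>M)" .
  interpret N: sigma_finite_measure "count_space (UNIV :: 'k set)"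
    by (rule sigma_finite_measure_count_space)
  show "(\<lambda>\<omega>. \<integral>\<^sup>+ q. (if Q q then marks_open \<beta> x y X U (K q) \<omega> else 0) \<partial>count_space UNIV) \<in> borel_measurable M"
    by (intro N.borel_measurable_nn_integral) 
      (auto simp: split_beta' intro!: measurable_compose_countable[where g=snd and f="\<lambda>q p. if Q q then marks_open \<beta> x y X U (K q) (fst p) else 0"])
qed

end

section \<open>Splitting pairs of paths by their common vertices\<close>

lemma nn_integral_count_split_two:
  fixes i j :: nat
  assumes "i \<noteq> j"
  shows "(\<integral>\<^sup>+ k. f k \<partial>count_space UNIV) = f i + f j + (\<integral>\<^sup>+ k. (if k \<noteq> i \<and> k \<noteq> j then f k else 0) \<partial>count_space UNIV)"
proof -
  have "(\<integral>\<^sup>+ k. f k \<partial>count_space UNIV)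
      = (\<integral>\<^sup>+ k. f k * indicator {i} k + f k * indicator {j} k + (if k \<noteq> i \<and> k \<noteq> j then f k else 0) \<partial>count_space UNIV)"
    using assms by (intro nn_integral_cong) (auto split: split_indicator)
  also have "\<dots> = f i + f j + (\<integral>\<^sup>+ k. (if k \<noteq> i \<and> k \<noteq> j then f k else 0) \<partial>count_space UNIV)"
    by (simp add: nn_integral_add)
  finally show ?thesis .
qed

lemma nn_integral_count_swap:
  "(\<integral>\<^sup>+ i. \<integral>\<^sup>+ j. f i j \<partial>count_space UNIV \<partial>count_space UNIV)
     = (\<integral>\<^sup>+ j. \<integral>\<^sup>+ i. f i j \<partial>count_space UNIV \<partial>count_space UNIV)"
  using nn_integral_fst_count_space[of "\<lambda>(i, j). f i j"] nn_integral_snd_count_space[of "\<lambda>(i, j). f i j"]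
  by simp

text \<open>The terms are, in order: equal pairs, reversed pairs, k = i, k = j, l = i, l = j, and
  disjoint pairs. In the triple sums the outermost index is the shared vertex, which matches the
  outer variable of the Gaussian integrals to come.\<close>

lemma nn_integral_count_two_pairs:
  fixes r :: "nat \<Rightarrow> nat \<Rightarrow> nat \<Rightarrow> nat \<Rightarrow> ennreal"
  shows "(\<integral>\<^sup>+ q. (if fst (fst q) \<noteq> snd (fst q) \<and> fst (snd q) \<noteq> snd (snd q)
      then r (fst (fst q)) (snd (fst q)) (fst (snd q)) (snd (snd q)) else 0) \<partial>count_space UNIV)
   = (\<integral>\<^sup>+ i. \<integral>\<^sup>+ j. (if distinct [i, j] then r i j i j else 0) \<partial>count_space UNIV \<partial>count_space UNIV)
   + (\<integral>\<^sup>+ i. \<integral>\<^sup>+ j. (if distinct [i, j] then r i j j i else 0) \<partial>count_space UNIV \<partial>count_space UNIV)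
   + (\<integral>\<^sup>+ i. \<integral>\<^sup>+ j. \<integral>\<^sup>+ k. (if distinct [i, j, k] then r i j i k else 0)
        \<partial>count_space UNIV \<partial>count_space UNIV \<partial>count_space UNIV)
   + (\<integral>\<^sup>+ j. \<integral>\<^sup>+ i. \<integral>\<^sup>+ k. (if distinct [j, i, k] then r i j j k else 0)
        \<partial>count_space UNIV \<partial>count_space UNIV \<partial>count_space UNIV)
   + (\<integral>\<^sup>+ i. \<integral>\<^sup>+ j. \<integral>\<^sup>+ k. (if distinct [i, j, k] then r i j k i else 0)
        \<partial>count_space UNIV \<partial>count_space UNIV \<partial>count_space UNIV)
   + (\<integral>\<^sup>+ j. \<integral>\<^sup>+ i. \<integral>\<^sup>+ k. (if distinct [j, i, k] then r i j k j else 0)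
        \<partial>count_space UNIV \<partial>count_space UNIV \<partial>count_space UNIV)
   + (\<integral>\<^sup>+ i. \<integral>\<^sup>+ j. \<integral>\<^sup>+ k. \<integral>\<^sup>+ l. (if distinct [i, j, k, l] then r i j k l else 0)
        \<partial>count_space UNIV \<partial>count_space UNIV \<partial>count_space UNIV \<partial>count_space UNIV)" (is "?L = ?A + ?B + ?C + ?D + ?E + ?F + ?G")
proof -
  let ?N = "count_space (UNIV :: nat set)"
  have inner: "(\<integral>\<^sup>+ k. \<integral>\<^sup>+ l. (if i \<noteq> j \<and> k \<noteq> l then r i j k l else 0) \<partial>?N \<partial>?N)
      = (if distinct [i, j] then r i j i j else 0) + (if distinct [i, j] then r i j j i else 0)
      + (\<integral>\<^sup>+ k. (if distinct [i, j, k] then r i j i k else 0) \<partial>?N)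
      + (\<integral>\<^sup>+ k. (if distinct [j, i, k] then r i j j k else 0) \<partial>?N)
      + (\<integral>\<^sup>+ k. (if distinct [i, j, k] then r i j k i else 0) \<partial>?N)
      + (\<integral>\<^sup>+ k. (if distinct [j, i, k] then r i j k j else 0) \<partial>?N)
      + (\<integral>\<^sup>+ k. \<integral>\<^sup>+ l. (if distinct [i, j, k, l] then r i j k l else 0) \<partial>?N \<partial>?N)" for i j
  proof (cases "i = j")
    case False
    let ?g = "\<lambda>k l. if i \<noteq> j \<and> k \<noteq> l then r i j k l else 0"
    \<comment> \<open>Both l and k are split into i, j and the rest. In the rows k = i and k = j the
      entry with l = k vanishes, which leaves two entries, four single sums and one double
      sum.\<close>
    have row: "(\<integral>\<^sup>+ l. ?g k l \<partial>?N) = ?g k i + ?g k j + (\<integral>\<^sup>+ l. (if l \<noteq> i \<and> l \<noteq> j then ?g k l else 0) \<partial>?N)" for k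
      by (rule nn_integral_count_split_two[OF False])
    have "(\<integral>\<^sup>+ k. \<integral>\<^sup>+ l. ?g k l \<partial>?N \<partial>?N)
        = (\<integral>\<^sup>+ l. ?g i l \<partial>?N) + (\<integral>\<^sup>+ l. ?g j l \<partial>?N)
        + (\<integral>\<^sup>+ k. (if k \<noteq> i \<and> k \<noteq> j then (\<integral>\<^sup>+ l. ?g k l \<partial>?N) else 0) \<partial>?N)"
      by (rule nn_integral_count_split_two[OF False])
    also have "(\<integral>\<^sup>+ k. (if k \<noteq> i \<and> k \<noteq> j then (\<integral>\<^sup>+ l. ?g k l \<partial>?N) else 0) \<partial>?N)
       = (\<integral>\<^sup>+ k. (if distinct [i, j, k] then r i j k i else 0) + (if distinct [j, i, k] then r i j k j else 0)
           + (\<integral>\<^sup>+ l. (if distinct [i, j, k, l] then r i j k l else 0) \<partial>?N) \<partial>?N)"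
      unfolding row using False by (intro nn_integral_cong) (auto intro!: nn_integral_cong arg_cong2[where f="(+)"])
    also have "\<dots> = (\<integral>\<^sup>+ k. (if distinct [i, j, k] then r i j k i else 0) \<partial>?N)
      + (\<integral>\<^sup>+ k. (if distinct [j, i, k] then r i j k j else 0) \<partial>?N)
      + (\<integral>\<^sup>+ k. \<integral>\<^sup>+ l. (if distinct [i, j, k, l] then r i j k l else 0) \<partial>?N \<partial>?N)"
      by (simp only: nn_integral_add borel_measurable_count_space)
    also have "(\<integral>\<^sup>+ l. ?g i l \<partial>?N) = r i j i j + (\<integral>\<^sup>+ k. (if distinct [i, j, k] then r i j i k else 0) \<partial>?N)"
      unfolding row using False by (auto intro!: nn_integral_cong arg_cong2[where f="(+)"])
    also have "(\<integral>\<^sup>+ l. ?g j l \<partial>?N) = r i j j i + (\<integral>\<^sup>+ k. (if distinct [j, i, k] then r i j j k else 0) \<partial>?N)"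
      unfolding row using False by (auto intro!: nn_integral_cong arg_cong2[where f="(+)"])
    finally show ?thesis
      using False by (simp add: ac_simps)
  qed simp
  have "?L = (\<integral>\<^sup>+ p. \<integral>\<^sup>+ q. (if fst p \<noteq> snd p \<and> fst q \<noteq> snd q then r (fst p) (snd p) (fst q) (snd q) else 0)
      \<partial>count_space UNIV \<partial>count_space UNIV)"
    by (rule nn_integral_count_pair[where f="\<lambda>p q. if fst p \<noteq> snd p \<and> fst q \<noteq> snd q
        then r (fst p) (snd p) (fst q) (snd q) else 0"])
  also have "\<dots> = (\<integral>\<^sup>+ p. \<integral>\<^sup>+ k. \<integral>\<^sup>+ l. (if fst p \<noteq> snd p \<and> k \<noteq> l then r (fst p) (snd p) k l else 0)
      \<partial>?N \<partial>?N \<partial>count_space UNIV)"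
    by (intro nn_integral_cong nn_integral_count_pair)
  also have "\<dots> = (\<integral>\<^sup>+ i. \<integral>\<^sup>+ j. \<integral>\<^sup>+ k. \<integral>\<^sup>+ l. (if i \<noteq> j \<and> k \<noteq> l then r i j k l else 0) \<partial>?N \<partial>?N \<partial>?N \<partial>?N)"
    by (rule nn_integral_count_pair[where f="\<lambda>i j. \<integral>\<^sup>+ k. \<integral>\<^sup>+ l. (if i \<noteq> j \<and> k \<noteq> l then r i j k l else 0) \<partial>?N \<partial>?N"])
  also have "\<dots> = ?A + ?B + ?C
    + (\<integral>\<^sup>+ i. \<integral>\<^sup>+ j. \<integral>\<^sup>+ k. (if distinct [j, i, k] then r i j j k else 0) \<partial>?N \<partial>?N \<partial>?N) + ?E
    + (\<integral>\<^sup>+ i. \<integral>\<^sup>+ j. \<integral>\<^sup>+ k. (if distinct [j, i, k] then r i j k j else 0) \<partial>?N \<partial>?N \<partial>?N) + ?G"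
    by (simp only: inner nn_integral_add borel_measurable_count_space)
  \<comment> \<open>Here j is the shared vertex, so its sum is moved outermost; the same happens for
    l = j.\<close>
  also have "(\<integral>\<^sup>+ i. \<integral>\<^sup>+ j. \<integral>\<^sup>+ k. (if distinct [j, i, k] then r i j j k else 0) \<partial>?N \<partial>?N \<partial>?N) = ?D"
    by (rule nn_integral_count_swap)
  also have "(\<integral>\<^sup>+ i. \<integral>\<^sup>+ j. \<integral>\<^sup>+ k. (if distinct [j, i, k] then r i j k j else 0) \<partial>?N \<partial>?N \<partial>?N) = ?F"
    by (rule nn_integral_count_swap)
  finally show ?thesis .
qed

section \<open>Path weights\<close>

text \<open>With rate \<beta> this is the connection probability except at p = q, where it is 1 and
  \<open>gaussH\<close> gives 0.\<close>

definition gauss_weight :: "real \<Rightarrow> real^2 \<Rightarrow> real^2 \<Rightarrow> ennreal" where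
  "gauss_weight s p q = ennreal (exp (- s * (norm (p - q))\<^sup>2))"

lemma gauss_weight_commute: "gauss_weight s p q = gauss_weight s q p"
  by (simp add: gauss_weight_def norm_minus_commute)

lemma gauss_weight_mult: "gauss_weight s p q * gauss_weight t p q = gauss_weight (s + t) p q"
  by (simp add: gauss_weight_def exp_add[symmetric] algebra_simps flip: ennreal_mult)

lemma gauss_weight_measurable [measurable]:
  "gauss_weight s p \<in> borel_measurable borel" "(\<lambda>p. gauss_weight s p q) \<in> borel_measurable borel"
  unfolding gauss_weight_def by measurable

lemma gaussH_norm_eq_gauss_weight: "p \<noteq> q \<Longrightarrow> ennreal (gaussH \<beta> (norm (p - q))) = gauss_weight \<beta> p q"
  by (simp add: gauss_weight_def gaussH_def)

text \<open>Points are null, so the convention H(0) = 0 does not affect integrals. Three exceptional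
  points are provided because in \<open>reversed_middle_edge\<close> one vertex is joined to three
  others.\<close>

lemma nn_integral_intensity_measure_cong:
  assumes "\<And>z. z \<notin> {p, q, r} \<Longrightarrow> f z = g z"
  shows "integral\<^sup>N (intensity_measure \<rho>) f = integral\<^sup>N (intensity_measure \<rho>) g"
proof (rule nn_integral_cong_AE)
  have "AE z in intensity_measure \<rho>. z \<noteq> c" for c
    using AE_lborel_singleton[of c] by (subst AE_density) auto
  then have "AE z in intensity_measure \<rho>. z \<noteq> p \<and> z \<noteq> q \<and> z \<noteq> r"
    by (intro AE_conjI)
  then show "AE z in intensity_measure \<rho>. f z = g z"
    by eventually_elim (use assms in auto)
qed

text \<open>The series law for rates: the reciprocals of s and t add up. The case t = 0 yields the
  total mass of a single weight.\<close>

lemma nn_integral_gauss_weight_two: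
  assumes "\<rho> > 0" "s + t > 0"
  shows "(\<integral>\<^sup>+ z. gauss_weight s p z * gauss_weight t z q \<partial>intensity_measure \<rho>)
       = ennreal (\<rho> * pi / (s + t)) * gauss_weight (s * t / (s + t)) p q"
proof -
  have "(\<integral>\<^sup>+ z. gauss_weight s p z * gauss_weight t z q \<partial>intensity_measure \<rho>)
      = ennreal \<rho> * (\<integral>\<^sup>+ z. gauss_weight s p z * gauss_weight t z q \<partial>lborel)"
    by (simp add: nn_integral_density nn_integral_cmult)
  also have "(\<integral>\<^sup>+ z. gauss_weight s p z * gauss_weight t z q \<partial>lborel)
      = (\<integral>\<^sup>+ z. ennreal (exp (- (s * (norm (z - p))\<^sup>2 + t * (norm (z - q))\<^sup>2))) \<partial>lborel)"
    by (simp add: gauss_weight_def norm_minus_commute[of p] exp_add[symmetric] flip: ennreal_mult)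
  also have "\<dots> = ennreal (pi / (s + t) * exp (- (s * t / (s + t)) * (norm (p - q))\<^sup>2))"
    by (rule nn_integral_gauss_two_centers[OF assms(2)])
  finally show ?thesis
    using assms by (simp add: gauss_weight_def mult.assoc flip: ennreal_mult)
qed

lemma nn_integral_gauss_weight:
  assumes "\<rho> > 0" "s > 0"
  shows "(\<integral>\<^sup>+ z. gauss_weight s p z \<partial>intensity_measure \<rho>) = ennreal (\<rho> * pi / s)"
  using nn_integral_gauss_weight_two[of \<rho> s 0 p p] assms by (simp add: gauss_weight_def)

text \<open>With equal rates the centroid is the midpoint, so two edges at z turn into one edge to a
  fixed centre. This prepares the integral with three centres.\<close>

lemma gauss_weight_midpoint:
  "gauss_weight s p z * gauss_weight s z q = gauss_weight (s / 2) p q * gauss_weight (2 * s) (midpoint p q) z"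
proof -
  have "(norm (z - p))\<^sup>2 + (norm (z - q))\<^sup>2 = 2 * (norm (z - midpoint p q))\<^sup>2 + (norm (p - q))\<^sup>2 / 2"
    using weighted_sum_norm_squares[of 1 1 z p q]
    by (simp add: midpoint_def scaleR_add_right diff_diff_eq inverse_eq_divide)
  then have "s * (norm (z - p))\<^sup>2 + s * (norm (z - q))\<^sup>2 = s / 2 * (norm (p - q))\<^sup>2 + 2 * s * (norm (z - midpoint p q))\<^sup>2"
    by (simp add: distrib_left[symmetric]) (simp add: algebra_simps)
  then show ?thesis
    by (simp add: gauss_weight_def norm_minus_commute[of _ z] exp_add[symmetric] flip: ennreal_mult)
qed

section \<open>The Gaussian integrals of the coincidence cases\<close>

locale gauss_paths =
  fixes \<rho> \<beta> :: real and x y :: "real^2"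
  assumes \<rho>: "\<rho> > 0" and \<beta>: "\<beta> > 0"
begin

abbreviation \<nu> :: "(real^2) measure" where "\<nu> \<equiv> intensity_measure \<rho>"

abbreviation H :: "real^2 \<Rightarrow> real^2 \<Rightarrow> ennreal" where "H p q \<equiv> ennreal (gaussH \<beta> (norm (p - q)))"

lemma two_hop:
  "(\<integral>\<^sup>+ b. H p b * H b q \<partial>\<nu>) = ennreal (\<rho> * pi / (2 * \<beta>)) * gauss_weight (\<beta> / 2) p q"
proof -
  have "(\<integral>\<^sup>+ b. H p b * H b q \<partial>\<nu>) = (\<integral>\<^sup>+ b. gauss_weight \<beta> p b * gauss_weight \<beta> b q \<partial>\<nu>)"
    by (rule nn_integral_intensity_measure_cong[of p q q]) (auto simp: gaussH_norm_eq_gauss_weight)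
  then show ?thesis
    using nn_integral_gauss_weight_two[of \<rho> \<beta> \<beta> p q] \<rho> \<beta> by (simp add: field_simps)
qed

text \<open>Integrating b leaves rate \<beta>/2 between a and y, and in series with \<beta> this
  gives \<beta>/3.\<close>

lemma three_hop:
  "(\<integral>\<^sup>+ a. \<integral>\<^sup>+ b. H x a * (H a b * H b y) \<partial>\<nu> \<partial>\<nu>)
     = ennreal (\<rho>\<^sup>2 * pi\<^sup>2 / (3 * \<beta>\<^sup>2)) * gauss_weight (\<beta> / 3) x y"
proof -
  have "(\<integral>\<^sup>+ a. \<integral>\<^sup>+ b. H x a * (H a b * H b y) \<partial>\<nu> \<partial>\<nu>)
      = (\<integral>\<^sup>+ a. H x a * (ennreal (\<rho> * pi / (2 * \<beta>)) * gauss_weight (\<beta> / 2) a y) \<partial>\<nu>)"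
    by (simp add: nn_integral_cmult two_hop)
  also have "\<dots> = (\<integral>\<^sup>+ a. ennreal (\<rho> * pi / (2 * \<beta>)) * (gauss_weight \<beta> x a * gauss_weight (\<beta> / 2) a y) \<partial>\<nu>)"
    by (rule nn_integral_intensity_measure_cong[of x x x]) (auto simp: gaussH_norm_eq_gauss_weight ac_simps)
  also have "\<dots> = ennreal (\<rho> * pi / (2 * \<beta>)) * (ennreal (\<rho> * pi / (\<beta> + \<beta> / 2)) * gauss_weight (\<beta> * (\<beta> / 2) / (\<beta> + \<beta> / 2)) x y)"
    using \<rho> \<beta> by (subst nn_integral_cmult) (simp_all add: nn_integral_gauss_weight_two)
  also have "\<beta> * (\<beta> / 2) / (\<beta> + \<beta> / 2) = \<beta> / 3" using \<beta> by (simp add: field_simps)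
  also have "ennreal (\<rho> * pi / (2 * \<beta>)) * (ennreal (\<rho> * pi / (\<beta> + \<beta> / 2)) * gauss_weight (\<beta> / 3) x y)
      = ennreal (\<rho>\<^sup>2 * pi\<^sup>2 / (3 * \<beta>\<^sup>2)) * gauss_weight (\<beta> / 3) x y"
  proof -
    have "\<rho> * pi / (2 * \<beta>) * (\<rho> * pi / (\<beta> + \<beta> / 2)) = \<rho>\<^sup>2 * pi\<^sup>2 / (3 * \<beta>\<^sup>2)"
      using \<beta> by (simp add: field_simps power2_eq_square)
    then show ?thesis
      using \<rho> \<beta> by (simp add: mult.assoc[symmetric] flip: ennreal_mult)
  qed
  finally show ?thesis .
qed

text \<open>Given a, the integrals over b and c separate into two equal two-hop factors, whose rates
  add to \<beta>; a two-hop integral over a remains. Stating it for p and q covers a shared first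
  edge and, with x and y exchanged, a shared last edge.\<close>

lemma shared_end_vertex:
  "(\<integral>\<^sup>+ a. \<integral>\<^sup>+ b. \<integral>\<^sup>+ c. H p a * ((H a b * H b q) * (H a c * H c q)) \<partial>\<nu> \<partial>\<nu> \<partial>\<nu>)
     = ennreal (\<rho> ^ 3 * pi ^ 3 / (8 * \<beta> ^ 3)) * gauss_weight (\<beta> / 2) p q"
proof -
  let ?c = "\<rho> * pi / (2 * \<beta>)"
  have "(\<integral>\<^sup>+ a. \<integral>\<^sup>+ b. \<integral>\<^sup>+ c. H p a * ((H a b * H b q) * (H a c * H c q)) \<partial>\<nu> \<partial>\<nu> \<partial>\<nu>)
      = (\<integral>\<^sup>+ a. H p a * ((ennreal ?c * gauss_weight (\<beta> / 2) a q) * (ennreal ?c * gauss_weight (\<beta> / 2) a q)) \<partial>\<nu>)"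
    by (simp add: nn_integral_cmult nn_integral_multc two_hop)
  also have "\<dots> = (\<integral>\<^sup>+ a. ennreal ?c * ennreal ?c * (gauss_weight \<beta> p a * (gauss_weight (\<beta> / 2) a q * gauss_weight (\<beta> / 2) a q)) \<partial>\<nu>)"
    by (rule nn_integral_intensity_measure_cong[of p p p]) (auto simp: gaussH_norm_eq_gauss_weight ac_simps)
  also have "\<dots> = ennreal ?c * ennreal ?c * (\<integral>\<^sup>+ a. gauss_weight \<beta> p a * gauss_weight \<beta> a q \<partial>\<nu>)"
    by (simp add: gauss_weight_mult nn_integral_cmult)
  also have "\<dots> = ennreal ?c * ennreal ?c * (ennreal (\<rho> * pi / (\<beta> + \<beta>)) * gauss_weight (\<beta> * \<beta> / (\<beta> + \<beta>)) p q)"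
    using \<rho> \<beta> by (subst nn_integral_gauss_weight_two) simp_all
  also have "\<beta> * \<beta> / (\<beta> + \<beta>) = \<beta> / 2" using \<beta> by (simp add: field_simps)
  also have "ennreal ?c * ennreal ?c * (ennreal (\<rho> * pi / (\<beta> + \<beta>)) * gauss_weight (\<beta> / 2) p q)
      = ennreal (\<rho> ^ 3 * pi ^ 3 / (8 * \<beta> ^ 3)) * gauss_weight (\<beta> / 2) p q"
  proof -
    have "?c * ?c * (\<rho> * pi / (\<beta> + \<beta>)) = \<rho> ^ 3 * pi ^ 3 / (8 * \<beta> ^ 3)"
      using \<beta> by (simp add: field_simps power3_eq_cube)
    then show ?thesis
      using \<rho> \<beta> by (simp add: mult.assoc[symmetric] flip: ennreal_mult)
  qed
  finally show ?thesis .
qed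

text \<open>The vertex a is first on one path and second on the other, so the paths share no edge.
  Integrating b and c adds a rate \<beta>/2 parallel to each of the edges at p and q, so two rates
  3\<beta>/2 in series remain.\<close>

lemma shared_middle_vertex:
  "(\<integral>\<^sup>+ a. \<integral>\<^sup>+ b. \<integral>\<^sup>+ c. (H p a * H a q) * ((H a b * H b q) * (H p c * H c a)) \<partial>\<nu> \<partial>\<nu> \<partial>\<nu>)
     = ennreal (\<rho> ^ 3 * pi ^ 3 / (12 * \<beta> ^ 3)) * gauss_weight (3 * \<beta> / 4) p q"
proof -
  let ?c = "\<rho> * pi / (2 * \<beta>)"
  have "(\<integral>\<^sup>+ a. \<integral>\<^sup>+ b. \<integral>\<^sup>+ c. (H p a * H a q) * ((H a b * H b q) * (H p c * H c a)) \<partial>\<nu> \<partial>\<nu> \<partial>\<nu>)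
      = (\<integral>\<^sup>+ a. (H p a * H a q) * ((ennreal ?c * gauss_weight (\<beta> / 2) a q) * (ennreal ?c * gauss_weight (\<beta> / 2) p a)) \<partial>\<nu>)"
    by (simp add: nn_integral_cmult nn_integral_multc two_hop)
  also have "\<dots> = (\<integral>\<^sup>+ a. ennreal ?c * ennreal ?c * ((gauss_weight \<beta> p a * gauss_weight (\<beta> / 2) p a)
        * (gauss_weight \<beta> a q * gauss_weight (\<beta> / 2) a q)) \<partial>\<nu>)"
    by (rule nn_integral_intensity_measure_cong[of p q q]) (auto simp: gaussH_norm_eq_gauss_weight ac_simps)
  also have "\<dots> = ennreal ?c * ennreal ?c * (\<integral>\<^sup>+ a. gauss_weight (3 / 2 * \<beta>) p a * gauss_weight (3 / 2 * \<beta>) a q \<partial>\<nu>)"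
  proof -
    have "\<beta> + \<beta> / 2 = 3 / 2 * \<beta>" by simp
    then show ?thesis unfolding gauss_weight_mult by (simp only:) (simp add: nn_integral_cmult)
  qed
  also have "\<dots> = ennreal ?c * ennreal ?c * (ennreal (\<rho> * pi / (3 / 2 * \<beta> + 3 / 2 * \<beta>))
      * gauss_weight (3 / 2 * \<beta> * (3 / 2 * \<beta>) / (3 / 2 * \<beta> + 3 / 2 * \<beta>)) p q)"
    using \<rho> \<beta> by (subst nn_integral_gauss_weight_two) simp_all
  also have "3 / 2 * \<beta> * (3 / 2 * \<beta>) / (3 / 2 * \<beta> + 3 / 2 * \<beta>) = 3 * \<beta> / 4" using \<beta> by (simp add: field_simps)
  also have "ennreal ?c * ennreal ?c * (ennreal (\<rho> * pi / (3 / 2 * \<beta> + 3 / 2 * \<beta>)) * gauss_weight (3 * \<beta> / 4) p q)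
      = ennreal (\<rho> ^ 3 * pi ^ 3 / (12 * \<beta> ^ 3)) * gauss_weight (3 * \<beta> / 4) p q"
  proof -
    have "?c * ?c * (\<rho> * pi / (3 / 2 * \<beta> + 3 / 2 * \<beta>)) = \<rho> ^ 3 * pi ^ 3 / (12 * \<beta> ^ 3)"
      using \<beta> by (simp add: field_simps power3_eq_cube)
    then show ?thesis
      using \<rho> \<beta> by (simp add: mult.assoc[symmetric] flip: ennreal_mult)
  qed
  finally show ?thesis .
qed

text \<open>The inner integrand has three centres x, y and a; \<open>gauss_weight_midpoint\<close>
  merges x and y into one. The graph is a balanced bridge: the common edge between a and b affects
  the prefactor but not the exponent, which is \<beta>/2 + \<beta>/2.\<close>

lemma reversed_middle_edge:
  "(\<integral>\<^sup>+ a. \<integral>\<^sup>+ b. (H x a * H a y) * ((H x b * H b y) * H a b) \<partial>\<nu> \<partial>\<nu>)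
     = ennreal (\<rho>\<^sup>2 * pi\<^sup>2 / (8 * \<beta>\<^sup>2)) * gauss_weight \<beta> x y"
proof -
  let ?m = "midpoint x y" and ?g = "gauss_weight (\<beta> / 2) x y"
  have inner: "(\<integral>\<^sup>+ b. (H x b * H b y) * H a b \<partial>\<nu>)
      = ?g * (ennreal (\<rho> * pi / (3 * \<beta>)) * gauss_weight (2 / 3 * \<beta>) ?m a)" for a
  proof -
    have "(\<integral>\<^sup>+ b. (H x b * H b y) * H a b \<partial>\<nu>)
        = (\<integral>\<^sup>+ b. (gauss_weight \<beta> x b * gauss_weight \<beta> b y) * gauss_weight \<beta> b a \<partial>\<nu>)"
      by (rule nn_integral_intensity_measure_cong[of x y a])
        (auto simp: gaussH_norm_eq_gauss_weight gauss_weight_commute[of _ a])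
    also have "\<dots> = ?g * (\<integral>\<^sup>+ b. gauss_weight (2 * \<beta>) ?m b * gauss_weight \<beta> b a \<partial>\<nu>)"
      unfolding gauss_weight_midpoint by (simp add: mult.assoc nn_integral_cmult)
    also have "(\<integral>\<^sup>+ b. gauss_weight (2 * \<beta>) ?m b * gauss_weight \<beta> b a \<partial>\<nu>)
        = ennreal (\<rho> * pi / (2 * \<beta> + \<beta>)) * gauss_weight (2 * \<beta> * \<beta> / (2 * \<beta> + \<beta>)) ?m a"
      using \<rho> \<beta> by (intro nn_integral_gauss_weight_two) simp_all
    also have "2 * \<beta> * \<beta> / (2 * \<beta> + \<beta>) = 2 / 3 * \<beta>" using \<beta> by (simp add: field_simps)
    also have "2 * \<beta> + \<beta> = 3 * \<beta>" by simp
    finally show ?thesis .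
  qed
  have "(\<integral>\<^sup>+ a. \<integral>\<^sup>+ b. (H x a * H a y) * ((H x b * H b y) * H a b) \<partial>\<nu> \<partial>\<nu>)
      = (\<integral>\<^sup>+ a. (H x a * H a y) * (?g * (ennreal (\<rho> * pi / (3 * \<beta>)) * gauss_weight (2 / 3 * \<beta>) ?m a)) \<partial>\<nu>)"
    by (simp add: nn_integral_cmult inner)
  also have "\<dots> = (\<integral>\<^sup>+ a. (gauss_weight \<beta> x a * gauss_weight \<beta> a y)
      * (?g * (ennreal (\<rho> * pi / (3 * \<beta>)) * gauss_weight (2 / 3 * \<beta>) ?m a)) \<partial>\<nu>)"
    by (rule nn_integral_intensity_measure_cong[of x y y]) (auto simp: gaussH_norm_eq_gauss_weight)
  \<comment> \<open>Both remaining factors in a are centred at the midpoint, so their rates 2\<beta>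
    and 2\<beta>/3 simply add.\<close>
  also have "\<dots> = (\<integral>\<^sup>+ a. ennreal (\<rho> * pi / (3 * \<beta>)) * (?g * ?g)
      * (gauss_weight (2 * \<beta>) ?m a * gauss_weight (2 / 3 * \<beta>) ?m a) \<partial>\<nu>)"
    unfolding gauss_weight_midpoint by (simp add: ac_simps)
  also have "\<dots> = (\<integral>\<^sup>+ a. ennreal (\<rho> * pi / (3 * \<beta>)) * gauss_weight \<beta> x y * gauss_weight (8 / 3 * \<beta>) ?m a \<partial>\<nu>)"
  proof -
    have "2 * \<beta> + 2 / 3 * \<beta> = 8 / 3 * \<beta>" "\<beta> / 2 + \<beta> / 2 = \<beta>" by simp_all
    then show ?thesis unfolding gauss_weight_mult by (simp only:)
  qed
  also have "\<dots> = ennreal (\<rho> * pi / (3 * \<beta>)) * gauss_weight \<beta> x y * ennreal (\<rho> * pi / (8 / 3 * \<beta>))"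
    using \<rho> \<beta> by (subst nn_integral_cmult) (simp_all add: nn_integral_gauss_weight)
  also have "\<dots> = ennreal (\<rho>\<^sup>2 * pi\<^sup>2 / (8 * \<beta>\<^sup>2)) * gauss_weight \<beta> x y"
  proof -
    have "\<rho> * pi / (3 * \<beta>) * (\<rho> * pi / (8 / 3 * \<beta>)) = \<rho>\<^sup>2 * pi\<^sup>2 / (8 * \<beta>\<^sup>2)"
      using \<beta> by (simp add: field_simps power2_eq_square)
    then have "ennreal (\<rho> * pi / (3 * \<beta>)) * ennreal (\<rho> * pi / (8 / 3 * \<beta>)) = ennreal (\<rho>\<^sup>2 * pi\<^sup>2 / (8 * \<beta>\<^sup>2))"
      using \<rho> \<beta> by (simp flip: ennreal_mult)
    then show ?thesis by (simp only: ac_simps)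
  qed
  finally show ?thesis .
qed

end

section \<open>First and second moment\<close>

text \<open>The second, third and sixth patterns share one edge (middle, first and last
  respectively), which therefore appears once; in the fourth, fifth and seventh all six edges
  differ. The fourth and sixth are written with x and y exchanged, to fit the integrals already
  computed.\<close>

lemma marks_weight_Un_path_marks:
  fixes \<beta> x y Z
  defines "H \<equiv> \<lambda>p q. ennreal (gaussH \<beta> (norm (p - q)))"
  shows "distinct [i, j] \<Longrightarrow> marks_weight \<beta> x y Z (path_marks i j)
      = H x (Z i) * (H (Z i) (Z j) * H (Z j) y)" (is "_ \<Longrightarrow> ?A")
    and "distinct [i, j] \<Longrightarrow> marks_weight \<beta> x y Z (path_marks i j \<union> path_marks j i)
      = (H x (Z i) * H (Z i) y) * ((H x (Z j) * H (Z j) y) * H (Z i) (Z j))" (is "_ \<Longrightarrow> ?B")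
    and "distinct [i, j, k] \<Longrightarrow> marks_weight \<beta> x y Z (path_marks i j \<union> path_marks i k)
      = H x (Z i) * ((H (Z i) (Z j) * H (Z j) y) * (H (Z i) (Z k) * H (Z k) y))" (is "_ \<Longrightarrow> ?C")
    and "distinct [j, i, k] \<Longrightarrow> marks_weight \<beta> x y Z (path_marks i j \<union> path_marks j k)
      = (H y (Z j) * H (Z j) x) * ((H (Z j) (Z i) * H (Z i) x) * (H y (Z k) * H (Z k) (Z j)))" (is "_ \<Longrightarrow> ?D")
    and "distinct [i, j, k] \<Longrightarrow> marks_weight \<beta> x y Z (path_marks i j \<union> path_marks k i)
      = (H x (Z i) * H (Z i) y) * ((H (Z i) (Z j) * H (Z j) y) * (H x (Z k) * H (Z k) (Z i)))" (is "_ \<Longrightarrow> ?E")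
    and "distinct [j, i, k] \<Longrightarrow> marks_weight \<beta> x y Z (path_marks i j \<union> path_marks k j)
      = H y (Z j) * ((H (Z j) (Z i) * H (Z i) x) * (H (Z j) (Z k) * H (Z k) x))" (is "_ \<Longrightarrow> ?F")
    and "distinct [i, j, k, l] \<Longrightarrow> marks_weight \<beta> x y Z (path_marks i j \<union> path_marks k l)
      = (H x (Z i) * (H (Z i) (Z j) * H (Z j) y)) * (H x (Z k) * (H (Z k) (Z l) * H (Z l) y))" (is "_ \<Longrightarrow> ?G")
proof -
  have H: "H p q = H q p" for p q by (simp add: H_def norm_minus_commute)
  have w: "ennreal (conn_prob \<beta> x y (Ux i) Z) = H x (Z i)" "ennreal (conn_prob \<beta> x y (Uy i) Z) = H (Z i) y"
    "ennreal (conn_prob \<beta> x y (edge_mark i j) Z) = H (Z i) (Z j)" for i j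
    by (simp_all add: H_def)
  \<comment> \<open>\<open>prod.insert_if\<close> skips a mark already present, and
    \<open>edge_mark_eq_iff\<close> decides when this happens. The rules for
    \<open>conn_prob\<close> are removed below so that \<open>w\<close> still finds its left-hand
    sides.\<close>
  note simps = marks_weight_def path_marks_def Un_insert_left prod.insert_if edge_mark_eq_iff w
  show "distinct [i, j] \<Longrightarrow> ?A" "distinct [i, j, k] \<Longrightarrow> ?C" "distinct [i, j, k, l] \<Longrightarrow> ?G"
    by (simp_all add: simps del: conn_prob.simps conn_prob_edge_mark) (simp_all add: ac_simps)?
  show "distinct [i, j] \<Longrightarrow> ?B"
    by (simp add: simps del: conn_prob.simps conn_prob_edge_mark) (simp add: ac_simps H[of "Z j" "Z i"])
  show "distinct [j, i, k] \<Longrightarrow> ?D"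
    by (simp add: simps H[of y] H[of "Z j" x] H[of "Z j" "Z i"] H[of "Z i" x] H[of "Z k" "Z j"] del: conn_prob.simps conn_prob_edge_mark)
      (simp add: ac_simps)
  show "distinct [i, j, k] \<Longrightarrow> ?E"
    by (simp add: simps del: conn_prob.simps conn_prob_edge_mark) (simp add: ac_simps)
  show "distinct [j, i, k] \<Longrightarrow> ?F"
    by (simp add: simps H[of y] H[of "Z j" "Z i"] H[of "Z i" x] H[of "Z j" "Z k"] H[of "Z k" x] del: conn_prob.simps conn_prob_edge_mark)
      (simp add: ac_simps)
qed

context prob_space
begin

lemma nn_integral_num_paths:
  fixes x y :: "real^2"
  assumes P: "poisson_pp \<rho> X" and R: "rcm_marks X U" and \<rho>: "\<rho> > 0" and \<beta>: "\<beta> > 0"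
  shows "(\<integral>\<^sup>+ \<omega>. num_paths \<beta> x y X U \<omega> \<partial>M)
    = ennreal (\<rho>\<^sup>2 * pi\<^sup>2 / (3 * \<beta>\<^sup>2)) * gauss_weight (\<beta> / 3) x y"
proof -
  interpret gauss_paths \<rho> \<beta> x y by standard (fact \<rho> \<beta>)+
  have "(\<integral>\<^sup>+ \<omega>. num_paths \<beta> x y X U \<omega> \<partial>M)
      = (\<integral>\<^sup>+ \<omega>. (\<integral>\<^sup>+ p. (if fst p \<noteq> snd p then marks_weight \<beta> x y (\<lambda>i. X i \<omega>) (path_marks (fst p) (snd p)) else 0)
          \<partial>count_space UNIV) \<partial>M)"
    unfolding num_paths_def by (rule rcm_marks_sum(1)[OF R P \<beta>]) simp
  also have "\<dots> = (\<integral>\<^sup>+ \<omega>. (\<integral>\<^sup>+ i. \<integral>\<^sup>+ j. (if distinct [i, j]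
      then H x (X i \<omega>) * (H (X i \<omega>) (X j \<omega>) * H (X j \<omega>) y) else 0) \<partial>count_space UNIV \<partial>count_space UNIV) \<partial>M)"
  proof (rule nn_integral_cong)
    fix \<omega>
    show "(\<integral>\<^sup>+ p. (if fst p \<noteq> snd p then marks_weight \<beta> x y (\<lambda>i. X i \<omega>) (path_marks (fst p) (snd p)) else 0)
          \<partial>count_space UNIV)
      = (\<integral>\<^sup>+ i. \<integral>\<^sup>+ j. (if distinct [i, j]
      then H x (X i \<omega>) * (H (X i \<omega>) (X j \<omega>) * H (X j \<omega>) y) else 0) \<partial>count_space UNIV \<partial>count_space UNIV)"
      by (subst nn_integral_count_pair[where f="\<lambda>i j. if i \<noteq> j then marks_weight \<beta> x y (\<lambda>i. X i \<omega>) (path_marks i j) else 0"])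
        (intro nn_integral_cong, simp add: marks_weight_Un_path_marks(1))
  qed
  also have "\<dots> = (\<integral>\<^sup>+ a. \<integral>\<^sup>+ b. H x a * (H a b * H b y) \<partial>\<nu> \<partial>\<nu>)"
    by (rule campbell_pair[OF P \<rho>]) measurable
  finally show ?thesis by (simp only: three_hop)
qed

lemma nn_integral_num_paths_square:
  fixes x y :: "real^2"
  assumes P: "poisson_pp \<rho> X" and R: "rcm_marks X U" and \<rho>: "\<rho> > 0" and \<beta>: "\<beta> > 0"
  defines "m \<equiv> ennreal (\<rho>\<^sup>2 * pi\<^sup>2 / (3 * \<beta>\<^sup>2)) * gauss_weight (\<beta> / 3) x y"
  shows "(\<integral>\<^sup>+ \<omega>. (num_paths \<beta> x y X U \<omega>)\<^sup>2 \<partial>M) = m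
    + ennreal (\<rho>\<^sup>2 * pi\<^sup>2 / (8 * \<beta>\<^sup>2)) * gauss_weight \<beta> x y
    + 2 * (ennreal (\<rho> ^ 3 * pi ^ 3 / (8 * \<beta> ^ 3)) * gauss_weight (\<beta> / 2) x y)
    + 2 * (ennreal (\<rho> ^ 3 * pi ^ 3 / (12 * \<beta> ^ 3)) * gauss_weight (3 * \<beta> / 4) x y)
    + m\<^sup>2"
proof -
  interpret gauss_paths \<rho> \<beta> x y by standard (fact \<rho> \<beta>)+
  let ?N = "count_space (UNIV :: nat set)"
  define W where "W \<omega> i j k l = marks_weight \<beta> x y (\<lambda>i. X i \<omega>) (path_marks i j \<union> path_marks k l)" for \<omega> i j k l
  note W = marks_weight_Un_path_marks
  have [measurable]: "X i \<in> borel_measurable M" for i by (rule poisson_pp_measurable[OF P])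
  have XX[measurable]: "(\<lambda>\<omega> i. X i \<omega>) \<in> measurable M (PiM UNIV (\<lambda>_. borel))"
    using P by (simp add: poisson_pp_def)
  have [measurable]: "(\<lambda>\<omega>. W \<omega> i j k l) \<in> borel_measurable M" for i j k l
    unfolding W_def marks_weight_def
    by (intro borel_measurable_prod_ennreal measurable_compose[OF measurable_compose[OF XX conn_prob_measurable]]) simp
  have "(\<integral>\<^sup>+ \<omega>. (num_paths \<beta> x y X U \<omega>)\<^sup>2 \<partial>M)
      = (\<integral>\<^sup>+ \<omega>. (\<integral>\<^sup>+ q. (if fst (fst q) \<noteq> snd (fst q) \<and> fst (snd q) \<noteq> snd (snd q)
         then W \<omega> (fst (fst q)) (snd (fst q)) (fst (snd q)) (snd (snd q)) else 0) \<partial>count_space UNIV) \<partial>M)"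
    unfolding num_paths_square W_def by (rule rcm_marks_sum(1)[OF R P \<beta>]) simp
  also have "\<dots> = (\<integral>\<^sup>+ \<omega>.
       (\<integral>\<^sup>+ i. \<integral>\<^sup>+ j. (if distinct [i, j] then W \<omega> i j i j else 0) \<partial>?N \<partial>?N)
     + (\<integral>\<^sup>+ i. \<integral>\<^sup>+ j. (if distinct [i, j] then W \<omega> i j j i else 0) \<partial>?N \<partial>?N)
     + (\<integral>\<^sup>+ i. \<integral>\<^sup>+ j. \<integral>\<^sup>+ k. (if distinct [i, j, k] then W \<omega> i j i k else 0) \<partial>?N \<partial>?N \<partial>?N)
     + (\<integral>\<^sup>+ j. \<integral>\<^sup>+ i. \<integral>\<^sup>+ k. (if distinct [j, i, k] then W \<omega> i j j k else 0) \<partial>?N \<partial>?N \<partial>?N)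
     + (\<integral>\<^sup>+ i. \<integral>\<^sup>+ j. \<integral>\<^sup>+ k. (if distinct [i, j, k] then W \<omega> i j k i else 0) \<partial>?N \<partial>?N \<partial>?N)
     + (\<integral>\<^sup>+ j. \<integral>\<^sup>+ i. \<integral>\<^sup>+ k. (if distinct [j, i, k] then W \<omega> i j k j else 0) \<partial>?N \<partial>?N \<partial>?N)
     + (\<integral>\<^sup>+ i. \<integral>\<^sup>+ j. \<integral>\<^sup>+ k. \<integral>\<^sup>+ l. (if distinct [i, j, k, l] then W \<omega> i j k l else 0) \<partial>?N \<partial>?N \<partial>?N \<partial>?N) \<partial>M)"
    by (simp only: nn_integral_count_two_pairs)
  also have "\<dots> =
       (\<integral>\<^sup>+ \<omega>. (\<integral>\<^sup>+ i. \<integral>\<^sup>+ j. (if distinct [i, j] then W \<omega> i j i j else 0) \<partial>?N \<partial>?N) \<partial>M)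
     + (\<integral>\<^sup>+ \<omega>. (\<integral>\<^sup>+ i. \<integral>\<^sup>+ j. (if distinct [i, j] then W \<omega> i j j i else 0) \<partial>?N \<partial>?N) \<partial>M)
     + (\<integral>\<^sup>+ \<omega>. (\<integral>\<^sup>+ i. \<integral>\<^sup>+ j. \<integral>\<^sup>+ k. (if distinct [i, j, k] then W \<omega> i j i k else 0) \<partial>?N \<partial>?N \<partial>?N) \<partial>M)
     + (\<integral>\<^sup>+ \<omega>. (\<integral>\<^sup>+ j. \<integral>\<^sup>+ i. \<integral>\<^sup>+ k. (if distinct [j, i, k] then W \<omega> i j j k else 0) \<partial>?N \<partial>?N \<partial>?N) \<partial>M)
     + (\<integral>\<^sup>+ \<omega>. (\<integral>\<^sup>+ i. \<integral>\<^sup>+ j. \<integral>\<^sup>+ k. (if distinct [i, j, k] then W \<omega> i j k i else 0) \<partial>?N \<partial>?N \<partial>?N) \<partial>M)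
     + (\<integral>\<^sup>+ \<omega>. (\<integral>\<^sup>+ j. \<integral>\<^sup>+ i. \<integral>\<^sup>+ k. (if distinct [j, i, k] then W \<omega> i j k j else 0) \<partial>?N \<partial>?N \<partial>?N) \<partial>M)
     + (\<integral>\<^sup>+ \<omega>. (\<integral>\<^sup>+ i. \<integral>\<^sup>+ j. \<integral>\<^sup>+ k. \<integral>\<^sup>+ l. (if distinct [i, j, k, l] then W \<omega> i j k l else 0) \<partial>?N \<partial>?N \<partial>?N \<partial>?N) \<partial>M)"
    (is "_ = ?A + ?B + ?C + ?D + ?E + ?F + ?G")
    \<comment> \<open>Additivity of the outer integral needs measurability of the inner sums in the
      outcome; for series over \<open>nat\<close> this follows termwise.\<close>
    unfolding nn_integral_count_space_nat
    by (simp add: nn_integral_add del: distinct.simps)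
  also have "?A = (\<integral>\<^sup>+ a. \<integral>\<^sup>+ b. H x a * (H a b * H b y) \<partial>\<nu> \<partial>\<nu>)"
    unfolding W_def Un_absorb
    by (simp only: W(1) cong: if_cong) (rule campbell_pair[OF P \<rho>], measurable)
  also have "\<dots> = m" by (simp only: three_hop m_def)
  also have "?B = (\<integral>\<^sup>+ a. \<integral>\<^sup>+ b. (H x a * H a y) * ((H x b * H b y) * H a b) \<partial>\<nu> \<partial>\<nu>)"
    unfolding W_def by (simp only: W(2) cong: if_cong) (rule campbell_pair[OF P \<rho>], measurable)
  also note reversed_middle_edge
  also have "?C = (\<integral>\<^sup>+ a. \<integral>\<^sup>+ b. \<integral>\<^sup>+ c. H x a * ((H a b * H b y) * (H a c * H c y)) \<partial>\<nu> \<partial>\<nu> \<partial>\<nu>)"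
    unfolding W_def by (simp only: W(3) cong: if_cong) (rule campbell_triple[OF P \<rho>], measurable)
  also note shared_end_vertex
  \<comment> \<open>The shared vertex ends the first path and starts the second, the mirror image of
    \<open>?E\<close> under exchange of x and y.\<close>
  also have "?D = (\<integral>\<^sup>+ a. \<integral>\<^sup>+ b. \<integral>\<^sup>+ c. (H y a * H a x) * ((H a b * H b x) * (H y c * H c a)) \<partial>\<nu> \<partial>\<nu> \<partial>\<nu>)"
    unfolding W_def by (simp only: W(4) cong: if_cong) (rule campbell_triple[OF P \<rho>], measurable)
  also note shared_middle_vertex
  also have "?E = (\<integral>\<^sup>+ a. \<integral>\<^sup>+ b. \<integral>\<^sup>+ c. (H x a * H a y) * ((H a b * H b y) * (H x c * H c a)) \<partial>\<nu> \<partial>\<nu> \<partial>\<nu>)"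
    unfolding W_def by (simp only: W(5) cong: if_cong) (rule campbell_triple[OF P \<rho>], measurable)
  also note shared_middle_vertex
  also have "?F = (\<integral>\<^sup>+ a. \<integral>\<^sup>+ b. \<integral>\<^sup>+ c. H y a * ((H a b * H b x) * (H a c * H c x)) \<partial>\<nu> \<partial>\<nu> \<partial>\<nu>)"
    unfolding W_def by (simp only: W(6) cong: if_cong) (rule campbell_triple[OF P \<rho>], measurable)
  also note shared_end_vertex
  also have "?G = (\<integral>\<^sup>+ a. \<integral>\<^sup>+ b. \<integral>\<^sup>+ c. \<integral>\<^sup>+ d. (H x a * (H a b * H b y)) * (H x c * (H c d * H d y)) \<partial>\<nu> \<partial>\<nu> \<partial>\<nu> \<partial>\<nu>)"
    unfolding W_def by (simp only: W(7) cong: if_cong) (rule campbell_quadruple[OF P \<rho>], measurable)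
  \<comment> \<open>Disjoint paths share no edge, so the integrand factors, and this term cancels
    against the squared mean in the variance.\<close>
  also have "\<dots> = m\<^sup>2"
  proof -
    have T: "(\<lambda>a. \<integral>\<^sup>+ b. H x a * (H a b * H b y) \<partial>\<nu>) \<in> borel_measurable \<nu>"
      by (simp add: nn_integral_cmult two_hop)
    have "(\<integral>\<^sup>+ c. \<integral>\<^sup>+ d. t * (H x c * (H c d * H d y)) \<partial>\<nu> \<partial>\<nu>) = t * m" for t
    proof -
      have "(\<integral>\<^sup>+ c. \<integral>\<^sup>+ d. t * (H x c * (H c d * H d y)) \<partial>\<nu> \<partial>\<nu>)
          = (\<integral>\<^sup>+ c. t * (\<integral>\<^sup>+ d. H x c * (H c d * H d y) \<partial>\<nu>) \<partial>\<nu>)"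
        by (intro nn_integral_cong nn_integral_cmult) measurable
      also have "\<dots> = t * m"
        unfolding m_def three_hop[symmetric] by (rule nn_integral_cmult[OF T])
      finally show ?thesis .
    qed
    then have "(\<integral>\<^sup>+ a. \<integral>\<^sup>+ b. \<integral>\<^sup>+ c. \<integral>\<^sup>+ d. (H x a * (H a b * H b y)) * (H x c * (H c d * H d y)) \<partial>\<nu> \<partial>\<nu> \<partial>\<nu> \<partial>\<nu>)
        = (\<integral>\<^sup>+ a. \<integral>\<^sup>+ b. (H x a * (H a b * H b y)) * m \<partial>\<nu> \<partial>\<nu>)"
      by simp
    also have "\<dots> = (\<integral>\<^sup>+ a. (\<integral>\<^sup>+ b. H x a * (H a b * H b y) \<partial>\<nu>) * m \<partial>\<nu>)"
      by (intro nn_integral_cong nn_integral_multc) measurable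
    also have "\<dots> = (\<integral>\<^sup>+ a. \<integral>\<^sup>+ b. H x a * (H a b * H b y) \<partial>\<nu> \<partial>\<nu>) * m"
      by (rule nn_integral_multc[OF T])
    also have "\<dots> = m\<^sup>2"
      by (simp only: three_hop m_def power2_eq_square)
    finally show ?thesis .
  qed
  finally show ?thesis
    by (simp add: gauss_weight_commute[of _ y x] mult_2 ac_simps)
qed

end

text \<open>Integrability is part of the conclusion because a Bochner integral that does not exist
  has value 0; the formulas alone would not certify that the moments are finite.\<close>

theorem mainTheorem3:
  fixes M :: "'a measure" and \<rho> \<beta> :: real and x y :: "real^2"
    and X :: "nat \<Rightarrow> 'a \<Rightarrow> real^2" and U :: "mark_idx \<Rightarrow> 'a \<Rightarrow> real"
  assumes "prob_space M"
    and "\<rho> > 0" and "\<beta> > 0" and "x \<noteq> y"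
    and "prob_space.poisson_pp M \<rho> X"
    and "prob_space.rcm_marks M X U"
  shows "integrable M (sigma3 \<beta> x y X U)
    \<and> integrable M (\<lambda>\<omega>. (sigma3 \<beta> x y X U \<omega>)\<^sup>2)
    \<and> prob_space.expectation M (sigma3 \<beta> x y X U)
        = pi\<^sup>2 * \<rho>\<^sup>2 / (3 * \<beta>\<^sup>2) * exp (- \<beta> * (norm (x - y))\<^sup>2 / 3)
    \<and> prob_space.variance M (sigma3 \<beta> x y X U)
        = prob_space.expectation M (sigma3 \<beta> x y X U)
          + pi ^ 3 * \<rho> ^ 3 / \<beta> ^ 3 *
              (1/4 * exp (- \<beta> * (norm (x - y))\<^sup>2 / 2) + 1/6 * exp (- 3 * \<beta> * (norm (x - y))\<^sup>2 / 4))
          + pi\<^sup>2 * \<rho>\<^sup>2 / (8 * \<beta>\<^sup>2) * exp (- \<beta> * (norm (x - y))\<^sup>2)"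
proof -
  interpret prob_space M by fact
  note \<rho> = \<open>\<rho> > 0\<close> and \<beta> = \<open>\<beta> > 0\<close> and P = \<open>poisson_pp \<rho> X\<close> and R = \<open>rcm_marks X U\<close>
  let ?S = "num_paths \<beta> x y X U" and ?\<sigma> = "sigma3 \<beta> x y X U" and ?D = "(norm (x - y))\<^sup>2"
  define m where "m = pi\<^sup>2 * \<rho>\<^sup>2 / (3 * \<beta>\<^sup>2) * exp (- \<beta> * ?D / 3)"
  \<comment> \<open>The variance minus the mean, so the second moment has to be m + v + m^2.\<close>
  define v where "v = pi ^ 3 * \<rho> ^ 3 / \<beta> ^ 3 * (1/4 * exp (- \<beta> * ?D / 2) + 1/6 * exp (- 3 * \<beta> * ?D / 4))
      + pi\<^sup>2 * \<rho>\<^sup>2 / (8 * \<beta>\<^sup>2) * exp (- \<beta> * ?D)"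
  have nonneg: "m \<ge> 0" "v \<ge> 0" using \<rho> \<beta> by (simp_all add: m_def v_def)
  have [measurable]: "?S \<in> borel_measurable M"
    unfolding num_paths_def[abs_def] by (rule rcm_marks_sum(2)[OF R P \<beta>]) simp
  have \<sigma>[measurable]: "?\<sigma> \<in> borel_measurable M"
    unfolding sigma3_eq_num_paths[abs_def] by measurable
  have ES: "(\<integral>\<^sup>+ \<omega>. ?S \<omega> \<partial>M) = ennreal m"
    unfolding nn_integral_num_paths[OF P R \<rho> \<beta>] using \<rho> \<beta>
    by (simp add: m_def gauss_weight_def mult.commute[of "pi\<^sup>2"] flip: ennreal_mult)
  have ES2: "(\<integral>\<^sup>+ \<omega>. (?S \<omega>)\<^sup>2 \<partial>M) = ennreal (m + v + m\<^sup>2)"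
  proof -
    \<comment> \<open>Each three-point case occurs together with its mirror image, hence 1/4 = 2/8
      and 1/6 = 2/12.\<close>
    have "m + v + m\<^sup>2 = m + \<rho>\<^sup>2 * pi\<^sup>2 / (8 * \<beta>\<^sup>2) * exp (- \<beta> * ?D)
      + 2 * (\<rho> ^ 3 * pi ^ 3 / (8 * \<beta> ^ 3) * exp (- (\<beta> / 2) * ?D))
      + 2 * (\<rho> ^ 3 * pi ^ 3 / (12 * \<beta> ^ 3) * exp (- (3 * \<beta> / 4) * ?D)) + m\<^sup>2"
      by (simp add: v_def algebra_simps)
    moreover have "ennreal c * gauss_weight s x y = ennreal (c * exp (- s * ?D))" if "c \<ge> 0" for c s
      using that by (simp add: gauss_weight_def flip: ennreal_mult)
    moreover have "2 * ennreal c = ennreal (2 * c)" if "c \<ge> 0" for c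
      using that by (simp add: ennreal_mult)
    ultimately show ?thesis
      unfolding nn_integral_num_paths_square[OF P R \<rho> \<beta>]
        nn_integral_num_paths[OF P R \<rho> \<beta>, symmetric] ES
      using \<rho> \<beta> nonneg by (simp add: ennreal_power flip: ennreal_plus)
  qed
  \<comment> \<open>A finite mean excludes infinitely many paths almost surely, so the default value
    0 of \<open>sigma3\<close> there does not change its moments.\<close>
  have "AE \<omega> in M. ?S \<omega> \<noteq> \<infinity>"
    using ES by (intro nn_integral_PInf_AE) auto
  then have AE: "AE \<omega> in M. ennreal (?\<sigma> \<omega>) = ?S \<omega>"
    by eventually_elim (simp add: sigma3_eq_num_paths less_top)
  have n1: "(\<integral>\<^sup>+ \<omega>. ennreal (?\<sigma> \<omega>) \<partial>M) = ennreal m"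
    unfolding ES[symmetric] using AE by (rule nn_integral_cong_AE)
  have n2: "(\<integral>\<^sup>+ \<omega>. ennreal ((?\<sigma> \<omega>)\<^sup>2) \<partial>M) = ennreal (m + v + m\<^sup>2)"
    unfolding ES2[symmetric]
    by (rule nn_integral_cong_AE, use AE in eventually_elim)
      (simp add: sigma3_eq_num_paths flip: ennreal_power)
  have pos: "?\<sigma> \<omega> \<ge> 0" for \<omega> by (simp add: sigma3_def)
  have "has_bochner_integral M ?\<sigma> m"
    using n1 nonneg pos by (intro has_bochner_integral_nn_integral) auto
  then have i1: "integrable M ?\<sigma>" "expectation ?\<sigma> = m"
    by (auto simp: has_bochner_integral_iff)
  have "has_bochner_integral M (\<lambda>\<omega>. (?\<sigma> \<omega>)\<^sup>2) (m + v + m\<^sup>2)"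
    using n2 nonneg by (intro has_bochner_integral_nn_integral) auto
  then have i2: "integrable M (\<lambda>\<omega>. (?\<sigma> \<omega>)\<^sup>2)" "expectation (\<lambda>\<omega>. (?\<sigma> \<omega>)\<^sup>2) = m + v + m\<^sup>2"
    by (auto simp: has_bochner_integral_iff)
  have "variance ?\<sigma> = m + v"
    using variance_eq[OF i1(1) i2(1)] i1(2) i2(2) by simp
  then show ?thesis
    using i1 i2(1) by (simp add: m_def v_def)
qed

end
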